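(* Assume the negation of weak Vopěnka's principle, i.e. assume that there exists an orthogonality class in the category of graphs which is not reflective. Then there exists an orthogonality class in the category of abelian groups which is not reflective.
   Context: A graph is a set $X$ with a binary relation $R\subseteq X\times X$; maps of graphs are relation-preserving functions. In a category $\mathcal{C}$, a morphism $f:A\to B$ and an object $X$ are orthogonal, $f\perp X$, if $f$ induces a bijection $\mathrm{Hom}_{\mathcal{C}}(B,X)\to\mathrm{Hom}_{\mathcal{C}}(A,X)$. For a class $\mathcal{E}$ of morphisms, $\mathcal{E}^\perp$ is the class of objects orthogonal to every member of $\mathcal{E}$; for a class $\mathcal{D}$ of objects, $\mathcal{D}^\perp$ is the class of morphisms orthogonal to every member of $\mathcal{D}$. An orthogonality class is a class of objects of the form $\mathcal{E}^\perp$ for some (possibly proper) class $\mathcal{E}$ of morphisms. A class $\mathcal{D}$ of objects is reflective if for every object $A$ of $\mathcal{C}$ there is a morphism $f:A\to\bar A$ in $\mathcal{D}^\perp$ with $\bar A$ in $\mathcal{D}$. Weak Vopěnka's principle: every orthogonality class in the category of graphs is reflective. *)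

theory Defs
  imports "HOL-Algebra.Group"
begin

text \<open>
  The type \<open>'v\<close> together with \<open>elts\<close> plays the role of the universe of sets: the elements of
  \<open>'v\<close> are the sets, and \<open>elts x\<close> is the extension of \<open>x\<close>. Classes are arbitrary
  HOL sets over \<open>'v\<close> (or over structures built from it), so separation and replacement are
  the single second-order axioms. The axiom of choice for \<open>'v\<close> is inherited from HOL: the
  range of a HOL choice function on a set is again a set by replacement.
\<close>

locale zfc_universe =
  fixes elts :: "'v \<Rightarrow> 'v set"
  assumes extensionality: "elts x = elts y \<Longrightarrow> x = y"
    and foundation: "wf {(x, y). x \<in> elts y}"
    and pairing: "\<exists>z. elts z = {x, y}"
    and union: "\<exists>z. elts z = (\<Union>y\<in>elts x. elts y)"
    and powerset: "\<exists>z. elts z = {y. elts y \<subseteq> elts x}"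
    and separation: "S \<subseteq> elts x \<Longrightarrow> \<exists>z. elts z = S"
    and replacement: "\<exists>z. elts z = F ` elts x"
    and infinity: "\<exists>x. infinite (elts x)"

definition small :: "('v \<Rightarrow> 'v set) \<Rightarrow> 'v set \<Rightarrow> bool" where
  "small elts S \<longleftrightarrow> S \<in> range elts"

text \<open>
  Hom-sets need not be disjoint, so composition takes the source of the inner arrow
  as an extra argument and a morphism is a triple of source, target and arrow.
\<close>

record ('o, 'm) cat =
  Obj :: "'o set"
  Hom :: "'o \<Rightarrow> 'o \<Rightarrow> 'm set"
  Comp :: "'o \<Rightarrow> 'm \<Rightarrow> 'm \<Rightarrow> 'm"

locale category =
  fixes C :: "('o, 'm) cat"
  assumes comp_in_Hom: "\<lbrakk>X \<in> Obj C; Y \<in> Obj C; Z \<in> Obj C; f \<in> Hom C X Y; g \<in> Hom C Y Z\<rbrakk>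
      \<Longrightarrow> Comp C X g f \<in> Hom C X Z"
    and assoc: "\<lbrakk>W \<in> Obj C; X \<in> Obj C; Y \<in> Obj C; Z \<in> Obj C;
        f \<in> Hom C W X; g \<in> Hom C X Y; h \<in> Hom C Y Z\<rbrakk>
      \<Longrightarrow> Comp C W (Comp C X h g) f = Comp C W h (Comp C W g f)"
    and ident: "X \<in> Obj C \<Longrightarrow> \<exists>i\<in>Hom C X X. \<forall>Y\<in>Obj C.
        (\<forall>f\<in>Hom C X Y. Comp C X f i = f) \<and> (\<forall>f\<in>Hom C Y X. Comp C Y i f = f)"

definition Mor :: "('o, 'm) cat \<Rightarrow> ('o \<times> 'o \<times> 'm) set" where
  "Mor C = {(A, B, f). A \<in> Obj C \<and> B \<in> Obj C \<and> f \<in> Hom C A B}"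

fun orthogonal :: "('o, 'm) cat \<Rightarrow> 'o \<times> 'o \<times> 'm \<Rightarrow> 'o \<Rightarrow> bool" where
  "orthogonal C (A, B, f) X \<longleftrightarrow> bij_betw (\<lambda>g. Comp C A g f) (Hom C B X) (Hom C A X)"

definition perp_objects :: "('o, 'm) cat \<Rightarrow> ('o \<times> 'o \<times> 'm) set \<Rightarrow> 'o set" where
  "perp_objects C E = {X \<in> Obj C. \<forall>e\<in>E. orthogonal C e X}"

definition perp_morphisms :: "('o, 'm) cat \<Rightarrow> 'o set \<Rightarrow> ('o \<times> 'o \<times> 'm) set" where
  "perp_morphisms C D = {e \<in> Mor C. \<forall>X\<in>D. orthogonal C e X}"

definition orthogonality_class :: "('o, 'm) cat \<Rightarrow> 'o set \<Rightarrow> bool" where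
  "orthogonality_class C D \<longleftrightarrow> (\<exists>E. E \<subseteq> Mor C \<and> D = perp_objects C E)"

definition reflective :: "('o, 'm) cat \<Rightarrow> 'o set \<Rightarrow> bool" where
  "reflective C D \<longleftrightarrow> (\<forall>A\<in>Obj C. \<exists>B\<in>D. \<exists>f. (A, B, f) \<in> perp_morphisms C D)"

text \<open>
  In both categories below an arrow is a function that is \<open>undefined\<close> outside the source,
  so that hom-sets contain each structure-preserving map exactly once.
\<close>

type_synonym 'v graph = "'v set \<times> ('v \<times> 'v) set"

fun graph_hom :: "'v graph \<Rightarrow> 'v graph \<Rightarrow> ('v \<Rightarrow> 'v) set" where
  "graph_hom (X, R) (Y, S) = {f \<in> X \<rightarrow>\<^sub>E Y. \<forall>(x, x') \<in> R. (f x, f x') \<in> S}"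

definition graph_cat :: "('v \<Rightarrow> 'v set) \<Rightarrow> ('v graph, 'v \<Rightarrow> 'v) cat" where
  "graph_cat elts =
    \<lparr>Obj = {(X, R). small elts X \<and> R \<subseteq> X \<times> X},
     Hom = graph_hom,
     Comp = (\<lambda>A g f. compose (fst A) g f)\<rparr>"

text \<open>
  A record of type \<open>'v monoid\<close> also fixes irrelevant values of the multiplication outside
  the carrier, so one abelian group is represented by several (isomorphic) objects.
\<close>

definition ab_cat :: "('v \<Rightarrow> 'v set) \<Rightarrow> ('v monoid, 'v \<Rightarrow> 'v) cat" where
  "ab_cat elts =
    \<lparr>Obj = {G. comm_group G \<and> small elts (carrier G)},
     Hom = (\<lambda>G H. hom G H \<inter> extensional (carrier G)),
     Comp = (\<lambda>G g f. compose (carrier G) g f)\<rparr>"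

lemma category_graph_cat: "category (graph_cat elts)"
proof
  fix X Y Z :: "'a graph" and f g :: "'a \<Rightarrow> 'a"
  assume "X \<in> Obj (graph_cat elts)" "f \<in> Hom (graph_cat elts) X Y"
    "g \<in> Hom (graph_cat elts) Y Z"
  then show "Comp (graph_cat elts) X g f \<in> Hom (graph_cat elts) X Z"
    by (cases X; cases Y; cases Z) (fastforce simp: graph_cat_def compose_def PiE_iff)
next
  fix W X Y Z :: "'a graph" and f g h :: "'a \<Rightarrow> 'a"
  assume "f \<in> Hom (graph_cat elts) W X"
  then show "Comp (graph_cat elts) W (Comp (graph_cat elts) X h g) f =
      Comp (graph_cat elts) W h (Comp (graph_cat elts) W g f)"
    by (cases W; cases X) (auto simp: graph_cat_def compose_def PiE_iff fun_eq_iff)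
next
  fix X :: "'a graph"
  assume X: "X \<in> Obj (graph_cat elts)"
  show "\<exists>i\<in>Hom (graph_cat elts) X X. \<forall>Y\<in>Obj (graph_cat elts).
      (\<forall>f\<in>Hom (graph_cat elts) X Y. Comp (graph_cat elts) X f i = f) \<and>
      (\<forall>f\<in>Hom (graph_cat elts) Y X. Comp (graph_cat elts) Y i f = f)"
    using X by (intro bexI[where x = "\<lambda>x\<in>fst X. x"]; cases X)
      (auto simp: graph_cat_def compose_def PiE_iff fun_eq_iff extensional_def)
qed

lemma category_ab_cat: "category (ab_cat elts)"
proof
  fix X Y Z :: "'a monoid" and f g :: "'a \<Rightarrow> 'a"
  assume "X \<in> Obj (ab_cat elts)" "f \<in> Hom (ab_cat elts) X Y" "g \<in> Hom (ab_cat elts) Y Z"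
  then show "Comp (ab_cat elts) X g f \<in> Hom (ab_cat elts) X Z"
    by (auto simp: ab_cat_def hom_def compose_def Pi_iff comm_group_def group_def
        monoid.m_closed)
next
  fix W X Y Z :: "'a monoid" and f g h :: "'a \<Rightarrow> 'a"
  assume "f \<in> Hom (ab_cat elts) W X"
  then show "Comp (ab_cat elts) W (Comp (ab_cat elts) X h g) f =
      Comp (ab_cat elts) W h (Comp (ab_cat elts) W g f)"
    by (auto simp: ab_cat_def hom_def compose_def Pi_iff fun_eq_iff)
next
  fix X :: "'a monoid"
  assume X: "X \<in> Obj (ab_cat elts)"
  show "\<exists>i\<in>Hom (ab_cat elts) X X. \<forall>Y\<in>Obj (ab_cat elts).
      (\<forall>f\<in>Hom (ab_cat elts) X Y. Comp (ab_cat elts) X f i = f) \<and>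
      (\<forall>f\<in>Hom (ab_cat elts) Y X. Comp (ab_cat elts) Y i f = f)"
    using X by (intro bexI[where x = "\<lambda>x\<in>carrier X. x"])
      (auto simp: ab_cat_def hom_def compose_def Pi_iff fun_eq_iff extensional_def
        comm_group_def group_def monoid.m_closed)
qed

definition weak_vopenka_principle :: "('v \<Rightarrow> 'v set) \<Rightarrow> bool" where
  "weak_vopenka_principle elts \<longleftrightarrow>
    (\<forall>D. orthogonality_class (graph_cat elts) D \<longrightarrow> reflective (graph_cat elts) D)"

end

theory Submission
  imports Defs "HOL-Library.Function_Algebras" "HOL-Library.Countable_Set"
    "HOL-Computational_Algebra.Primes"
begin

text \<open>
  There is a functor \<open>G\<close> from graphs to abelian groups such that \<open>Hom (G X) (G Y)\<close> is the free
  abelian group on \<open>Hom X Y\<close>, so \<open>f \<bottom> X\<close> implies \<open>G f \<bottom> G X\<close>. It encodes the action of countably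
  many operations on the sequences in \<open>X\<close>, together with the edges, by divisibility of elements of a
  torsion-free group by powers of various primes. That a homomorphism is a finite combination of
  graph maps holds because countably many sequences can be merged into a single one, which bounds
  the supports of the images of basis elements.

  Let \<open>D\<close> be an orthogonality class of graphs, and suppose that in abelian groups the class orthogonal
  to all \<open>G (A \<rightarrow> B)\<close> with \<open>A \<rightarrow> B\<close> in \<open>D\<^sup>\<bottom>\<close> contains a reflection \<open>L\<close> of \<open>G A\<close>. For \<open>X\<close> in \<open>D\<close> and
  \<open>h : A \<rightarrow> X\<close>, each \<open>G B \<rightarrow> G X\<close> induced by the extension \<open>B \<rightarrow> X\<close> of \<open>h\<close> factors through \<open>L \<rightarrow> G X\<close>,
  so the hull of \<open>h\<close>, the union of the images of all these \<open>B\<close> in \<open>X\<close>, is no larger than \<open>L\<close>. Only a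
  set of hulls remains up to isomorphism, and this yields a reflection of \<open>A\<close> in \<open>D\<close>.
\<close>

text \<open>Freeness of the hom-groups is what transports orthogonality: a bijection between bases
  is an isomorphism of the free groups on them. The obstacle is finiteness. A homomorphism might a
  priori use different, and ever more, graph maps on different basis elements; nothing could exclude
  this if points were the basis, which is why sequences are used. Divisibility yields linear
  constraints: elements divisible by all powers of a prime go to such elements, and any functional
  that is integral at that prime kills them, so each prime turns one family of generators into one
  family of equations on coefficients. In the other direction the functor cannot be undone: the
  reflection \<open>L\<close> need not come from a graph. Only its cardinality is used. That
  suffices because orthogonality classes are closed under products, so what is missing for a
  reflection is a solution set as in the adjoint functor theorem, and a bound on the size of hulls
  supplies one.\<close>

section \<open>Localised spans in rational vector spaces\<close>

text \<open>The rules of an inductive set of functions are eta-expanded, so that these simp rules would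
  rewrite below the abstraction.\<close>

declare plus_fun_apply [simp del] zero_fun_apply [simp del]

definition supp :: "('b \<Rightarrow> rat) \<Rightarrow> 'b set" where
  "supp v = {x. v x \<noteq> 0}"

definition unit_vec :: "'b \<Rightarrow> 'b \<Rightarrow> rat" where
  "unit_vec x = (\<lambda>y. of_bool (y = x))"

lemma unit_vec_apply: "unit_vec x y = of_bool (y = x)"
  by (simp add: unit_vec_def)

definition scale :: "rat \<Rightarrow> ('b \<Rightarrow> rat) \<Rightarrow> 'b \<Rightarrow> rat" where
  "scale c v = (\<lambda>x. c * v x)"

text \<open>The linear functional given by the indicator of \<open>C\<close>; the restriction to the
  support keeps the sum finite for infinite \<open>C\<close>. All functionals applied to the groups
  below have this form.\<close>

definition csum :: "'b set \<Rightarrow> ('b \<Rightarrow> rat) \<Rightarrow> rat" where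
  "csum C v = (\<Sum>x\<in>C \<inter> supp v. v x)"

text \<open>The linear extension of \<open>k\<close> from basis elements to finite combinations,
  written with fibre sums.\<close>

definition push :: "('b \<Rightarrow> 'c) \<Rightarrow> ('b \<Rightarrow> rat) \<Rightarrow> 'c \<Rightarrow> rat" where
  "push k v = (\<lambda>y. csum (k -` {y}) v)"

lemma sum_fun_apply: "(\<Sum>i\<in>A. F i) x = (\<Sum>i\<in>A. F i x :: rat)"
  by (induction A rule: infinite_finite_induct) (simp_all add: zero_fun_def plus_fun_def)

lemma scale_add: "scale c (v + w) = scale c v + scale c w"
  by (simp add: scale_def fun_eq_iff plus_fun_apply algebra_simps)

lemma scale_diff: "scale c (v - w) = scale c v - scale c w"
  by (simp add: scale_def fun_eq_iff algebra_simps)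

lemma scale_scale: "scale c (scale d v) = scale (c * d) v"
  by (simp add: scale_def mult.assoc)

lemma scale_0 [simp]: "scale c 0 = 0" "scale 0 v = 0"
  by (simp_all add: scale_def zero_fun_def)

lemma scale_1 [simp]: "scale 1 v = v"
  by (simp add: scale_def)

lemma scale_add_left: "scale (c + d) v = scale c v + scale d v"
  by (simp add: scale_def fun_eq_iff plus_fun_apply algebra_simps)

lemma scale_cancel: "c \<noteq> 0 \<Longrightarrow> scale c v = scale c w \<longleftrightarrow> v = w"
  by (simp add: scale_def fun_eq_iff)

lemma finite_supp_add: "finite (supp v) \<Longrightarrow> finite (supp w) \<Longrightarrow> finite (supp (v + w))"
  by (rule finite_subset[of _ "supp v \<union> supp w"]) (auto simp: supp_def plus_fun_apply)

lemma finite_supp_scale: "finite (supp v) \<Longrightarrow> finite (supp (scale c v))"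
  by (rule finite_subset[of _ "supp v"]) (auto simp: supp_def scale_def)

lemma supp_0 [simp]: "supp 0 = {}"
  by (simp add: supp_def zero_fun_apply)

lemma supp_unit_vec [simp]: "supp (unit_vec x) = {x}"
  by (auto simp: supp_def unit_vec_def)

lemma csum_superset:
  assumes "finite F" "supp v \<subseteq> F"
  shows "csum C v = (\<Sum>x\<in>F. if x \<in> C then v x else 0)"
proof -
  have "(\<Sum>x\<in>F. if x \<in> C then v x else 0) = (\<Sum>x\<in>F \<inter> C. v x)"
    using assms(1) by (simp add: sum.inter_restrict)
  also have "\<dots> = (\<Sum>x\<in>C \<inter> supp v. v x)"
    using assms by (intro sum.mono_neutral_right) (auto simp: supp_def plus_fun_apply)
  finally show ?thesis by (simp add: csum_def)
qed

lemma csum_add: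
  assumes "finite (supp v)" "finite (supp w)"
  shows "csum C (v + w) = csum C v + csum C w"
proof -
  let ?F = "supp v \<union> supp w"
  have sub: "supp (v + w) \<subseteq> ?F" "supp v \<subseteq> ?F" "supp w \<subseteq> ?F" by (auto simp: supp_def plus_fun_apply)
  have fin: "finite ?F" using assms by simp
  show ?thesis
    unfolding sub[THEN csum_superset[OF fin]] sum.distrib[symmetric]
    by (intro sum.cong) (auto simp: plus_fun_apply)
qed

lemma csum_scale: "csum C (scale c v) = c * csum C v"
  by (cases "c = 0") (simp_all add: csum_def scale_def supp_def sum_distrib_left)

lemma csum_0 [simp]: "csum C 0 = 0"
  by (simp add: csum_def)

lemma csum_unit_vec [simp]: "csum C (unit_vec x) = of_bool (x \<in> C)"
  by (auto simp: csum_def) (simp add: unit_vec_def)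

lemma csum_diff:
  assumes "finite (supp v)" "finite (supp w)"
  shows "csum C (v - w) = csum C v - csum C w"
proof -
  have *: "v - w = v + scale (- 1) w" by (simp add: scale_def fun_eq_iff plus_fun_apply)
  show ?thesis unfolding * using assms by (simp add: csum_add finite_supp_scale csum_scale)
qed

lemma csum_singleton [simp]: "csum {x} v = v x"
  by (cases "v x = 0") (auto simp: csum_def supp_def Int_insert_left)

lemma push_add:
  "finite (supp v) \<Longrightarrow> finite (supp w) \<Longrightarrow> push k (v + w) = push k v + push k w"
  by (simp add: push_def fun_eq_iff plus_fun_apply csum_add)

lemma push_diff:
  "finite (supp v) \<Longrightarrow> finite (supp w) \<Longrightarrow> push k (v - w) = push k v - push k w"
  by (simp add: push_def fun_eq_iff csum_diff)

lemma push_scale: "push k (scale c v) = scale c (push k v)"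
  by (simp add: push_def fun_eq_iff csum_scale) (simp add: scale_def)

lemma push_0 [simp]: "push k 0 = 0"
  by (simp add: push_def fun_eq_iff zero_fun_apply)

lemma push_unit_vec [simp]: "push k (unit_vec x) = unit_vec (k x)"
  by (auto simp: push_def fun_eq_iff unit_vec_def[of "k x"])


section \<open>The localisation of the integers at a prime\<close>

definition integral_at :: "nat \<Rightarrow> rat \<Rightarrow> bool" where
  "integral_at p x \<longleftrightarrow> (\<exists>a b::int. \<not> int p dvd b \<and> x * of_int b = of_int a)"

lemma integral_at_add:
  assumes "prime p" "integral_at p x" "integral_at p y"
  shows "integral_at p (x + y)"
proof -
  obtain a b c d :: int where *: "\<not> int p dvd b" "x * of_int b = of_int a"
      "\<not> int p dvd d" "y * of_int d = of_int c"
    using assms(2,3) unfolding integral_at_def by blast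
  have "(x + y) * of_int (b * d) = (x * of_int b) * of_int d + (y * of_int d) * of_int b"
    by (simp add: algebra_simps)
  also have "\<dots> = of_int (a * d + c * b)" using * by simp
  finally have "(x + y) * of_int (b * d) = of_int (a * d + c * b)" .
  moreover have "\<not> int p dvd b * d" using * assms(1) by (simp add: prime_dvd_mult_iff)
  ultimately show ?thesis unfolding integral_at_def by blast
qed

lemma integral_at_Ints: "prime p \<Longrightarrow> x \<in> \<int> \<Longrightarrow> integral_at p x"
  unfolding integral_at_def by (rule Ints_cases[of x], simp, rule exI, rule exI[of _ 1])
    (auto simp: prime_int_numeral_eq dest: prime_gt_1_nat)

lemma integral_at_frac:
  assumes "prime p" "prime q" "p \<noteq> q"
  shows "integral_at p (of_int a / of_nat q ^ n)"
proof -
  have "\<not> p dvd q ^ n" using assms by (metis prime_dvd_power primes_dvd_imp_eq)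
  then have "\<not> int p dvd int (q ^ n)" by (simp only: int_dvd_int_iff not_False_eq_True)
  moreover have "of_int a / of_nat q ^ n * of_int (int (q ^ n)) = (of_int a :: rat)"
    using assms(2) prime_gt_0_nat[of q] by simp
  ultimately show ?thesis unfolding integral_at_def by blast
qed

lemma integral_at_divisible:
  assumes "prime p" "\<And>n. \<exists>y. integral_at p y \<and> x = of_nat p ^ n * y"
  shows "x = 0"
proof (rule ccontr)
  assume "x \<noteq> 0"
  obtain a b where ab: "x = of_int a / of_int b" "b > 0"
    by (metis quotient_of_div quotient_of_denom_pos surj_pair)
  with \<open>x \<noteq> 0\<close> have "a \<noteq> 0" by auto
  have "int p ^ n dvd a" for n
  proof -
    obtain y c d where "\<not> int p dvd d" "y * of_int d = of_int c" "x = of_nat p ^ n * y"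
      using assms(2)[of n] unfolding integral_at_def by blast
    then have "of_int (a * d) = (of_int (int p ^ n * c * b) :: rat)"
      using ab by (simp add: field_simps)
    then have "a * d = int p ^ n * c * b" by (simp only: of_int_eq_iff)
    then have "int p ^ n dvd a * d" by simp
    moreover have "coprime (int p ^ n) d"
      using \<open>\<not> int p dvd d\<close> assms(1) by (simp add: prime_imp_coprime)
    ultimately show ?thesis by (simp add: coprime_dvd_mult_left_iff)
  qed
  \<comment> \<open>The exponent is chosen so that the power exceeds the absolute value of the
    nonzero integer \<open>a\<close>.\<close>
  then have *: "int p ^ nat \<bar>a\<bar> dvd a" by blast
  have "int p ^ nat \<bar>a\<bar> \<le> \<bar>a\<bar>" using dvd_imp_le_int[OF \<open>a \<noteq> 0\<close> *] by simp
  moreover have "nat \<bar>a\<bar> < p ^ nat \<bar>a\<bar>"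
    using power_gt_expt[of p] prime_gt_1_nat[OF assms(1)] by simp
  ultimately show False by (simp add: nat_less_iff)
qed

lemma integral_at_all_imp_Ints:
  assumes "\<And>p. prime p \<Longrightarrow> integral_at p x"
  shows "x \<in> \<int>"
proof -
  obtain a b where ab: "quotient_of x = (a, b)" by fastforce
  then have x: "x = of_int a / of_int b" "b > 0" "coprime a b"
    using quotient_of_div quotient_of_denom_pos quotient_of_coprime by auto
  have "b = 1"
  proof (rule ccontr)
    assume "b \<noteq> 1"
    then have "nat b \<noteq> 1" using x by simp
    then obtain p where p: "prime p" "p dvd nat b" using prime_factor_nat by blast
    then have pb: "int p dvd b" using x by (metis int_dvd_int_iff int_nat_eq less_imp_le)
    obtain c d where "\<not> int p dvd d" "x * of_int d = of_int c"
      using assms[OF p(1)] unfolding integral_at_def by blast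
    then have "of_int (a * d) = (of_int (c * b) :: rat)" using x by (simp add: field_simps)
    then have "a * d = c * b" by (simp only: of_int_eq_iff)
    then have "int p dvd a * d" using pb by simp
    then have "int p dvd a"
      using p(1) \<open>\<not> int p dvd d\<close> by (simp add: prime_dvd_mult_iff)
    with pb x(3) p(1) show False by (meson coprime_common_divisor not_prime_unit prime_nat_int_transfer)
  qed
  then show ?thesis using x by simp
qed

section \<open>Subgroups with prescribed divisibility and additive maps on them\<close>

definition additive_on :: "('b \<Rightarrow> rat) set \<Rightarrow> (('b \<Rightarrow> rat) \<Rightarrow> 'c \<Rightarrow> rat) \<Rightarrow> bool" where
  "additive_on S \<phi> \<longleftrightarrow> (\<forall>v\<in>S. \<forall>w\<in>S. \<phi> (v + w) = \<phi> v + \<phi> w)"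

text \<open>The subgroup generated by the elements of all \<open>g \<tau>\<close> and their
  quotients by powers of \<open>p \<tau>\<close>. The rules append one fraction at a time, so that
  an induction meets only a single new term; closure under sums is then a lemma.\<close>

inductive_set divspan :: "('t \<Rightarrow> nat) \<Rightarrow> ('t \<Rightarrow> ('b \<Rightarrow> rat) set) \<Rightarrow> ('b \<Rightarrow> rat) set"
  for p :: "'t \<Rightarrow> nat" and g :: "'t \<Rightarrow> ('b \<Rightarrow> rat) set" where
  zero: "0 \<in> divspan p g"
| step: "v \<in> divspan p g \<Longrightarrow> w \<in> g \<tau> \<Longrightarrow>
    v + scale (of_int a / of_nat (p \<tau>) ^ n) w \<in> divspan p g"

lemma divspan_gen_frac: "w \<in> g \<tau> \<Longrightarrow> scale (of_int a / of_nat (p \<tau>) ^ n) w \<in> divspan p g"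
  using divspan.step[OF divspan.zero, of w g \<tau> a p n] by simp

lemma divspan_gen: "w \<in> g \<tau> \<Longrightarrow> w \<in> divspan p g"
  using divspan_gen_frac[of w g \<tau> 1 p 0] by simp

lemma divspan_add:
  assumes "w \<in> divspan p g" "v \<in> divspan p g"
  shows "v + w \<in> divspan p g"
  using assms(1)
proof induction
  case zero
  show ?case using assms(2) by simp
next
  case (step u w \<tau> a n)
  show ?case unfolding add.assoc[symmetric] using step.IH step.hyps(2) by (rule divspan.step)
qed

lemma divspan_scale_int:
  assumes "v \<in> divspan p g"
  shows "scale (of_int b) v \<in> divspan p g"
  using assms
proof induction
  case (step v w \<tau> a n)
  have "scale (of_int b) (v + scale (of_int a / of_nat (p \<tau>) ^ n) w) =
      scale (of_int b) v + scale (of_int (b * a) / of_nat (p \<tau>) ^ n) w"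
    by (simp add: scale_add scale_scale)
  then show ?case by (simp only: divspan.step[OF step.IH step.hyps(2)])
qed (simp add: divspan.zero)

lemma divspan_diff:
  assumes "v \<in> divspan p g" "w \<in> divspan p g"
  shows "v - w \<in> divspan p g"
proof -
  have *: "v - w = v + scale (of_int (- 1)) w" by (simp add: scale_def fun_eq_iff plus_fun_apply)
  show ?thesis
    unfolding * by (rule divspan_add[OF divspan_scale_int[OF assms(2)] assms(1)])
qed

lemma divspan_sum_scale:
  "(\<And>i. i \<in> A \<Longrightarrow> F i \<in> divspan p g) \<Longrightarrow> (\<And>i. i \<in> A \<Longrightarrow> n i \<in> \<int>) \<Longrightarrow>
    (\<Sum>i\<in>A. scale (n i) (F i)) \<in> divspan p g"
proof (induction A rule: infinite_finite_induct)
  case (insert i A)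
  have "scale (n i) (F i) \<in> divspan p g"
    using insert.prems[of i] by (auto elim!: Ints_cases intro: divspan_scale_int)
  then show ?case using insert by (simp add: divspan_add)
qed (simp_all add: divspan.zero)

lemma finite_supp_divspan:
  assumes "\<And>\<tau> w. w \<in> g \<tau> \<Longrightarrow> finite (supp w)" "v \<in> divspan p g"
  shows "finite (supp v)"
  using assms(2) by induction (simp_all add: assms(1) finite_supp_add finite_supp_scale)

text \<open>Powers of \<open>q\<close> enter denominators only through generators whose prime is
  \<open>q\<close>, and the functional vanishes on those; all other denominators are prime to
  \<open>q\<close>.\<close>

lemma divspan_integral_at:
  assumes fin: "\<And>\<tau> w. w \<in> g \<tau> \<Longrightarrow> finite (supp w)"
    and int: "\<And>\<tau> w. w \<in> g \<tau> \<Longrightarrow> csum C w \<in> \<int>"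
    and p: "\<And>\<tau>. prime (p \<tau>)" and q: "prime q"
    and kills: "\<And>\<tau> w. p \<tau> = q \<Longrightarrow> w \<in> g \<tau> \<Longrightarrow> csum C w = 0"
    and v: "v \<in> divspan p g"
  shows "integral_at q (csum C v)"
  using v
proof induction
  case zero
  show ?case using q by (simp add: integral_at_Ints)
next
  case (step v w \<tau> a n)
  have "integral_at q (of_int a / of_nat (p \<tau>) ^ n * csum C w)"
  proof (cases "p \<tau> = q")
    case True
    then show ?thesis using kills step q by (simp add: integral_at_Ints)
  next
    case False
    obtain b where "csum C w = of_int b" using int[OF step.hyps(2)] by (auto elim: Ints_cases)
    then show ?thesis using integral_at_frac[OF q p, of \<tau> "a * b" n] False by simp
  qed
  moreover have "finite (supp v)" using fin step.hyps(1) by (rule finite_supp_divspan)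
  moreover have "finite (supp w)" using fin step.hyps(2) .
  ultimately show ?case using integral_at_add[OF q step.IH]
    by (simp add: csum_add csum_scale finite_supp_scale)
qed

lemma additive_on_0: "additive_on (divspan p g) \<phi> \<Longrightarrow> \<phi> 0 = 0"
  unfolding additive_on_def using divspan.zero by fastforce

lemma additive_on_diff:
  assumes "additive_on (divspan p g) \<phi>" "v \<in> divspan p g" "w \<in> divspan p g"
  shows "\<phi> (v - w) = \<phi> v - \<phi> w"
proof -
  have "\<phi> (v - w + w) = \<phi> (v - w) + \<phi> w"
    using assms divspan_diff[OF assms(2,3)] unfolding additive_on_def by blast
  then show ?thesis by (simp add: eq_diff_eq)
qed

lemma additive_on_scale_nat:
  assumes "additive_on (divspan p g) \<phi>" "v \<in> divspan p g"
  shows "\<phi> (scale (of_nat n) v) = scale (of_nat n) (\<phi> v)"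
proof (induction n)
  case 0
  then show ?case using assms(1) by (simp add: additive_on_0)
next
  case (Suc n)
  have "scale (of_nat n) v \<in> divspan p g"
    using divspan_scale_int[OF assms(2), of "int n"] by simp
  then show ?case
    using Suc assms by (simp add: scale_add_left additive_on_def)
qed

text \<open>A homomorphism preserves divisibility by all powers of a prime, and a linear functional
  that is integral at that prime kills such elements.\<close>

lemma additive_on_kills:
  assumes fin: "\<And>\<tau> w. w \<in> g' \<tau> \<Longrightarrow> finite (supp w)"
    and int: "\<And>\<tau> w. w \<in> g' \<tau> \<Longrightarrow> csum C w \<in> \<int>"
    and p: "\<And>\<tau>. prime (p \<tau>)" "inj p"
    and kills: "\<And>w. w \<in> g' \<tau> \<Longrightarrow> csum C w = 0"
    and \<phi>: "additive_on (divspan p g) \<phi>" "\<phi> ` divspan p g \<subseteq> divspan p g'"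
    and w: "w \<in> g \<tau>"
  shows "csum C (\<phi> w) = 0"
proof (rule integral_at_divisible[OF p(1)[of \<tau>]])
  fix n
  let ?w = "scale (of_int 1 / of_nat (p \<tau>) ^ n) w"
  have "p \<tau> \<noteq> 0" using p(1)[of \<tau>] by auto
  then have "w = scale (of_nat (p \<tau> ^ n)) ?w" by (simp add: scale_scale)
  moreover have w': "?w \<in> divspan p g" using w by (rule divspan_gen_frac)
  ultimately have "\<phi> w = scale (of_nat (p \<tau> ^ n)) (\<phi> ?w)"
    using additive_on_scale_nat[OF \<phi>(1) w', of "p \<tau> ^ n"] by simp
  then have "csum C (\<phi> w) = of_nat (p \<tau>) ^ n * csum C (\<phi> ?w)" by (simp add: csum_scale)
  \<comment> \<open>By injectivity of \<open>p\<close>, the only target generators whose prime is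
    \<open>p \<tau>\<close> are those in \<open>g' \<tau>\<close>, which the functional
    kills.\<close>
  moreover have "integral_at (p \<tau>) (csum C (\<phi> ?w))"
    by (rule divspan_integral_at[of g', OF fin int p(1) p(1)[of \<tau>]])
      (use kills p(2) \<phi>(2) w' in \<open>auto dest: injD\<close>)
  ultimately show "\<exists>y. integral_at (p \<tau>) y \<and> csum C (\<phi> w) = of_nat (p \<tau>) ^ n * y" by blast
qed

text \<open>The target is torsion-free: multiplication by a power of \<open>p \<tau>\<close> is
  injective on rational-valued functions, so the value at a generator determines the values at its
  fractions.\<close>

lemma additive_on_divspan_cong:
  assumes \<phi>: "additive_on (divspan p g) \<phi>" and \<psi>: "additive_on (divspan p g) \<psi>"
    and p: "\<And>\<tau>. prime (p \<tau>)"
    and gen: "\<And>\<tau> w. w \<in> g \<tau> \<Longrightarrow> \<phi> w = \<psi> w"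
    and v: "v \<in> divspan p g"
  shows "\<phi> v = \<psi> v"
  using v
proof induction
  case zero
  then show ?case using additive_on_0[OF \<phi>] additive_on_0[OF \<psi>] by simp
next
  case (step v w \<tau> a n)
  have frac: "scale (of_int b / of_nat (p \<tau>) ^ n) w \<in> divspan p g" for b
    using step.hyps(2) by (rule divspan_gen_frac)
  have w: "w \<in> divspan p g" using step.hyps(2) by (rule divspan_gen)
  have ne: "p \<tau> \<noteq> 0" using p[of \<tau>] by auto
  have eq: "\<phi> (scale (of_int (int b) / of_nat (p \<tau>) ^ n) w) =
      \<psi> (scale (of_int (int b) / of_nat (p \<tau>) ^ n) w)" for b
  proof -
    let ?u = "scale (of_int (int b) / of_nat (p \<tau>) ^ n) w"
    have "scale (of_nat (p \<tau> ^ n)) ?u = scale (of_nat b) w"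
      using ne by (simp add: scale_scale)
    then have "scale (of_nat (p \<tau> ^ n)) (\<phi> ?u) = scale (of_nat (p \<tau> ^ n)) (\<psi> ?u)"
      using additive_on_scale_nat[OF \<phi> frac, of "p \<tau> ^ n" "int b"]
        additive_on_scale_nat[OF \<psi> frac, of "p \<tau> ^ n" "int b"]
        additive_on_scale_nat[OF \<phi> w, of b]
        additive_on_scale_nat[OF \<psi> w, of b]
        gen[OF step.hyps(2)] by simp
    then show ?thesis using ne by (subst (asm) scale_cancel) simp_all
  qed
  \<comment> \<open>Compatibility with multiples is available for natural factors only, so the
    integer numerator is split into a difference.\<close>
  obtain b c where a: "a = int b - int c" using int_diff_cases by blast
  have "scale (of_int a / of_nat (p \<tau>) ^ n) w =
      scale (of_int (int b) / of_nat (p \<tau>) ^ n) w - scale (of_int (int c) / of_nat (p \<tau>) ^ n) w"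
    by (simp add: a scale_def fun_eq_iff plus_fun_apply field_simps diff_divide_distrib)
  then have "\<phi> (scale (of_int a / of_nat (p \<tau>) ^ n) w) = \<psi> (scale (of_int a / of_nat (p \<tau>) ^ n) w)"
    by (simp only: additive_on_diff[OF \<phi> frac frac] additive_on_diff[OF \<psi> frac frac] eq)
  moreover have "\<phi> (v + scale (of_int a / of_nat (p \<tau>) ^ n) w) =
      \<phi> v + \<phi> (scale (of_int a / of_nat (p \<tau>) ^ n) w)"
    using \<phi> frac step.hyps(1) unfolding additive_on_def by blast
  moreover have "\<psi> (v + scale (of_int a / of_nat (p \<tau>) ^ n) w) =
      \<psi> v + \<psi> (scale (of_int a / of_nat (p \<tau>) ^ n) w)"
    using \<psi> frac step.hyps(1) unfolding additive_on_def by blast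
  ultimately show ?case using step.IH by simp
qed

section \<open>Coherent families of sequences\<close>

datatype ix = Id | Row nat | Fix nat

instance ix :: countable
  by countable_datatype

text \<open>Sequences are read as \<open>\<nat> \<times> \<nat>\<close>-tables: \<open>Row r\<close> extracts row \<open>r\<close>, and \<open>Fix n\<close> makes all rows
  but row \<open>0\<close> constant, with their \<open>n\<close>-th entry as the value.\<close>

fun act :: "ix \<Rightarrow> nat \<Rightarrow> nat" where
  "act Id k = k"
| "act (Row r) k = prod_encode (r, k)"
| "act (Fix n) k = (case prod_decode k of (r, l) \<Rightarrow> if r = 0 then k else prod_encode (r, n))"

definition seqs :: "'a set \<Rightarrow> (nat \<Rightarrow> 'a) set" where
  "seqs Z = {s. range s \<subseteq> Z}"

definition join :: "(nat \<Rightarrow> nat \<Rightarrow> 'a) \<Rightarrow> nat \<Rightarrow> 'a" where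
  "join S k = (case prod_decode k of (r, l) \<Rightarrow> S r l)"

text \<open>Repeating \<open>s'\<close> in all rows other than row 0 makes this shape stable under
  \<open>Fix n\<close>, which just replaces \<open>s'\<close> by a constant sequence
  (\<open>join2_Fix\<close>).\<close>

definition join2 :: "(nat \<Rightarrow> 'a) \<Rightarrow> (nat \<Rightarrow> 'a) \<Rightarrow> nat \<Rightarrow> 'a" where
  "join2 s s' = join (\<lambda>r. if r = 0 then s else s')"

lemma act_Id [simp]: "s \<circ> act Id = s"
  by (simp add: fun_eq_iff)

lemma seqs_comp [simp]: "s \<in> seqs Z \<Longrightarrow> s \<circ> k \<in> seqs Z"
  by (auto simp: seqs_def)

lemma seqs_map: "s \<in> seqs Z \<Longrightarrow> (\<And>x. x \<in> Z \<Longrightarrow> h x \<in> Z') \<Longrightarrow> h \<circ> s \<in> seqs Z'"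
  by (auto simp: seqs_def)

lemma join_seqs: "(\<And>r. S r \<in> seqs Z) \<Longrightarrow> join S \<in> seqs Z"
  by (fastforce simp: seqs_def join_def split: prod.split)

lemma join_Row [simp]: "join S \<circ> act (Row r) = S r"
  by (simp add: fun_eq_iff join_def)

lemma join2_seqs: "s \<in> seqs Z \<Longrightarrow> s' \<in> seqs Z \<Longrightarrow> join2 s s' \<in> seqs Z"
  by (simp add: join2_def join_seqs)

lemma join2_Row [simp]: "join2 s s' \<circ> act (Row r) = (if r = 0 then s else s')"
  by (simp add: join2_def)

lemma join2_encode [simp]: "join2 s s' (prod_encode (r, k)) = (if r = 0 then s k else s' k)"
  by (simp add: join2_def join_def)

lemma join2_Fix: "join2 s s' \<circ> act (Fix n) = join2 s (\<lambda>_. s' n)"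
  by (auto simp: fun_eq_iff join2_def join_def split: prod.split)

lemma Fix_Row_0: "(u \<circ> act (Fix n)) \<circ> act (Row 0) = u \<circ> act (Row 0)"
  by (simp add: fun_eq_iff)

section \<open>Supports under pushforward\<close>

lemma supp_push_subset: "supp (push k v) \<subseteq> k ` supp v"
proof
  fix y assume "y \<in> supp (push k v)"
  then have "(\<Sum>x\<in>k -` {y} \<inter> supp v. v x) \<noteq> 0" by (simp add: supp_def push_def csum_def)
  then have "k -` {y} \<inter> supp v \<noteq> {}" by (metis sum.empty)
  then show "y \<in> k ` supp v" by auto
qed

text \<open>A support can shrink only by collision of basis elements or by cancellation of their
  coefficients. If its size does not drop, neither happens.\<close>

lemma push_card_eq:
  assumes "finite (supp v)" "card (supp v) \<le> card (supp (push k v))"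
  shows "bij_betw k (supp v) (supp (push k v))"
    and "x \<in> supp v \<Longrightarrow> push k v (k x) = v x"
proof -
  have le: "card (supp (push k v)) \<le> card (k ` supp v)"
    by (rule card_mono) (simp_all add: assms supp_push_subset)
  have "card (k ` supp v) \<le> card (supp v)" using assms(1) by (rule card_image_le)
  with le assms have "card (k ` supp v) = card (supp v)" by simp
  then have inj: "inj_on k (supp v)" using assms(1) by (simp add: eq_card_imp_inj_on)
  have "supp (push k v) = k ` supp v"
    by (rule card_subset_eq) (use assms le \<open>card (k ` supp v) \<le> card (supp v)\<close> in
      \<open>simp_all add: supp_push_subset\<close>)
  with inj show "bij_betw k (supp v) (supp (push k v))" by (simp add: bij_betw_def)
  assume x: "x \<in> supp v"
  then have "k -` {k x} \<inter> supp v = {x}" using inj by (auto dest: inj_onD)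
  then show "push k v (k x) = v x" by (simp add: push_def csum_def)
qed

lemma finite_supp_sum_unit_vec:
  "finite (supp (\<Sum>i\<in>A. scale (n i) (unit_vec (x i))))"
  by (induction A rule: infinite_finite_induct) (simp_all add: finite_supp_add finite_supp_scale)

lemma push_sum_unit_vec:
  "push k (\<Sum>i\<in>A. scale (n i) (unit_vec (x i))) = (\<Sum>i\<in>A. scale (n i) (unit_vec (k (x i))))"
  by (induction A rule: infinite_finite_induct)
    (simp_all add: push_add finite_supp_scale finite_supp_sum_unit_vec push_scale)

lemma sum_unit_vec:
  assumes "finite (supp v)"
  shows "v = (\<Sum>x\<in>supp v. scale (v x) (unit_vec x))"
proof
  fix y
  have "(\<Sum>x\<in>supp v. scale (v x) (unit_vec x)) y = (\<Sum>x\<in>supp v. if x = y then v x else 0)"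
    unfolding sum_fun_apply by (intro sum.cong) (auto simp: scale_def unit_vec_def)
  also have "\<dots> = v y" using assms by (simp add: supp_def)
  finally show "v y = (\<Sum>x\<in>supp v. scale (v x) (unit_vec x)) y" by simp
qed

text \<open>Supports are bounded because any countably many sequences are rows of a single one. A
  sequence \<open>a\<close> with support of maximal size then labels the supports of all \<open>c (join2 a s)\<close>
  coherently.\<close>

lemma coherent_family:
  fixes c :: "(nat \<Rightarrow> 'a) \<Rightarrow> (nat \<Rightarrow> 'b) \<Rightarrow> rat"
  assumes "Z \<noteq> {}"
    and fin: "\<And>s. s \<in> seqs Z \<Longrightarrow> finite (supp (c s))"
    and push: "\<And>s m. s \<in> seqs Z \<Longrightarrow> c (s \<circ> act m) = push (\<lambda>t. t \<circ> act m) (c s)"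
  obtains T :: "(nat \<Rightarrow> 'b) set" and n h where "finite T"
    and "\<And>s. s \<in> seqs Z \<Longrightarrow> c s = (\<Sum>t\<in>T. scale (n t) (unit_vec (h t \<circ> s)))"
    and "\<And>t. t \<in> T \<Longrightarrow> \<exists>s\<in>seqs Z. n t = c s t"
    and "\<And>t x y. t \<in> T \<Longrightarrow> x \<in> Z \<Longrightarrow> y \<in> Z \<Longrightarrow> \<exists>s\<in>seqs Z. \<exists>u\<in>supp (c s).
      s (prod_encode (1, 0)) = x \<and> s (prod_encode (1, 1)) = y \<and>
      u (prod_encode (1, 0)) = h t x \<and> u (prod_encode (1, 1)) = h t y"
proof -
  have "\<exists>N. \<forall>s\<in>seqs Z. card (supp (c s)) \<le> N"
  proof (rule ccontr)
    assume "\<not> ?thesis"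
    then have "\<forall>N. \<exists>s. s \<in> seqs Z \<and> card (supp (c s)) > N" by (auto simp: not_le)
    then obtain S where S: "\<And>N. S N \<in> seqs Z" "\<And>N. card (supp (c (S N))) > N" by metis
    \<comment> \<open>Every \<open>S N\<close> is a row of this single sequence, so the finite
      support of \<open>c ?J\<close> bounds the sizes of all the supports of
      \<open>c (S N)\<close>.\<close>
    let ?J = "join S"
    have J: "?J \<in> seqs Z" using S(1) by (rule join_seqs)
    have "card (supp (c (S N))) \<le> card (supp (c ?J))" for N
    proof -
      have "supp (c (S N)) \<subseteq> (\<lambda>t. t \<circ> act (Row N)) ` supp (c ?J)"
        using push[OF J, of "Row N"] supp_push_subset[of "\<lambda>t. t \<circ> act (Row N)" "c ?J"] by simp
      then show ?thesis using fin[OF J] by (rule surj_card_le[rotated])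
    qed
    then show False using S(2) by (meson leD)
  qed
  then obtain N where N: "\<And>s. s \<in> seqs Z \<Longrightarrow> card (supp (c s)) \<le> N" by blast
  obtain z where "z \<in> Z" using assms(1) by blast
  then have "(\<lambda>_. z) \<in> seqs Z" by (auto simp: seqs_def)
  then have "\<exists>a. a \<in> seqs Z \<and> (\<forall>s. s \<in> seqs Z \<longrightarrow> card (supp (c s)) \<le> card (supp (c a)))"
    using ex_has_greatest_nat[of "\<lambda>s. s \<in> seqs Z" "\<lambda>_. z" "\<lambda>s. card (supp (c s))" "Suc N"]
    by (simp add: N le_imp_less_Suc)
  then obtain a where a: "a \<in> seqs Z" "\<And>s. s \<in> seqs Z \<Longrightarrow> card (supp (c s)) \<le> card (supp (c a))"
    by blast
  define T where "T = supp (c a)"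
  define R0 where "R0 = (\<lambda>t :: nat \<Rightarrow> 'b. t \<circ> act (Row 0))"
  \<comment> \<open>For \<open>t\<close> in \<open>T\<close>, \<open>u s t\<close> is the only
    element of the support of \<open>c (join2 a s)\<close> with row 0 equal to \<open>t\<close>: row
    0 of \<open>join2 a s\<close> is \<open>a\<close>, whose support is maximal, so passing to row 0
    is a bijection of supports.\<close>
  define u where "u s = inv_into (supp (c (join2 a s))) R0" for s
  have J: "join2 a s \<in> seqs Z" if "s \<in> seqs Z" for s using a(1) that by (rule join2_seqs)
  have R0: "push R0 (c (join2 a s)) = c a" if "s \<in> seqs Z" for s
    using push[OF J[OF that], of "Row 0"] by (simp add: R0_def)
  have bij: "bij_betw R0 (supp (c (join2 a s))) T"
    and val: "x \<in> supp (c (join2 a s)) \<Longrightarrow> c a (R0 x) = c (join2 a s) x" if "s \<in> seqs Z" for s x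
    using push_card_eq[of "c (join2 a s)" R0] fin[OF J[OF that]] a(2)[OF J[OF that]] R0[OF that]
    by (simp_all add: T_def)
  have bij_u: "bij_betw (u s) T (supp (c (join2 a s)))" if "s \<in> seqs Z" for s
    unfolding u_def using bij[OF that] by (rule bij_betw_inv_into)
  have R0_u: "R0 (u s t) = t" if "s \<in> seqs Z" "t \<in> T" for s t
    unfolding u_def using bij_betw_inv_into_right[OF bij[OF that(1)] that(2)] .
  have u_mem: "u s t \<in> supp (c (join2 a s))" if "s \<in> seqs Z" "t \<in> T" for s t
    using bij_u that by (auto simp: bij_betw_def)
  have u_eq: "u s (R0 x) = x" if "s \<in> seqs Z" "x \<in> supp (c (join2 a s))" for s x
    unfolding u_def using bij_betw_inv_into_left[OF bij[OF that(1)] that(2)] .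
  have expand: "c (join2 a s) = (\<Sum>t\<in>T. scale (c a t) (unit_vec (u s t)))" if "s \<in> seqs Z" for s
  proof -
    have "c (join2 a s) = (\<Sum>x\<in>supp (c (join2 a s)). scale (c (join2 a s) x) (unit_vec x))"
      using fin[OF J[OF that]] by (rule sum_unit_vec)
    also have "\<dots> = (\<Sum>t\<in>T. scale (c (join2 a s) (u s t)) (unit_vec (u s t)))"
      using sum.reindex_bij_betw[OF bij_u[OF that],
        of "\<lambda>x. scale (c (join2 a s) x) (unit_vec x)"] by simp
    also have "\<dots> = (\<Sum>t\<in>T. scale (c a t) (unit_vec (u s t)))"
      using that by (intro sum.cong) (simp_all add: val[symmetric] u_mem R0_u)
    finally show ?thesis .
  qed
  \<comment> \<open>The value at \<open>x\<close> is read off from the constant sequence;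
    \<open>u_Row\<close> then shows that the same point map describes row 1 of \<open>u s t\<close>
    for every sequence \<open>s\<close>.\<close>
  define h where "h t x = u (\<lambda>_. x) t (prod_encode (1, 0))" for t x
  have u_Row: "u s t \<circ> act (Row 1) = h t \<circ> s" if s: "s \<in> seqs Z" and t: "t \<in> T" for s t
  proof
    fix k
    \<comment> \<open>\<open>Fix k\<close> keeps row 0 and turns row 1 into the constant sequence of
      the entry \<open>s k\<close>. The two supports have equal size, so it is a bijection between
      them, and it respects the labels in \<open>T\<close> because these are read from row
      0.\<close>
    let ?F = "\<lambda>t :: nat \<Rightarrow> 'b. t \<circ> act (Fix k)"
    have s': "(\<lambda>_. s k) \<in> seqs Z" using s by (auto simp: seqs_def)
    have F: "c (join2 a (\<lambda>_. s k)) = push ?F (c (join2 a s))"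
      using push[OF J[OF s], of "Fix k"] by (simp add: join2_Fix)
    have "card (supp (c (join2 a s))) = card (supp (push ?F (c (join2 a s))))"
      using bij_betw_same_card[OF bij[OF s]] bij_betw_same_card[OF bij[OF s']] F by simp
    then have "bij_betw ?F (supp (c (join2 a s))) (supp (c (join2 a (\<lambda>_. s k))))"
      unfolding F by (intro push_card_eq(1) fin J s) simp
    then have mem: "u s t \<circ> act (Fix k) \<in> supp (c (join2 a (\<lambda>_. s k)))"
      using u_mem[OF s t] by (auto simp: bij_betw_def)
    have "R0 (u s t \<circ> act (Fix k)) = t"
      using R0_u[OF s t] unfolding R0_def Fix_Row_0 .
    with u_eq[OF s' mem] have "u (\<lambda>_. s k) t = u s t \<circ> act (Fix k)" by simp
    then show "(u s t \<circ> act (Row 1)) k = (h t \<circ> s) k" by (simp add: h_def)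
  qed
  show ?thesis
  proof (rule that[of T "c a" h])
    show "finite T" unfolding T_def using a(1) by (rule fin)
    show "\<exists>s\<in>seqs Z. c a t = c s t" for t using a(1) by blast
    fix s assume s: "s \<in> seqs Z"
    have "c s = push (\<lambda>t. t \<circ> act (Row 1)) (c (join2 a s))"
      using push[OF J[OF s], of "Row 1"] by simp
    also have "\<dots> = (\<Sum>t\<in>T. scale (c a t) (unit_vec (u s t \<circ> act (Row 1))))"
      unfolding expand[OF s] by (rule push_sum_unit_vec)
    also have "\<dots> = (\<Sum>t\<in>T. scale (c a t) (unit_vec (h t \<circ> s)))"
      by (intro sum.cong) (simp_all only: u_Row[OF s])
    finally show "c s = (\<Sum>t\<in>T. scale (c a t) (unit_vec (h t \<circ> s)))" .
  next
    fix t x y assume t: "t \<in> T" and "x \<in> Z" "y \<in> Z"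
    \<comment> \<open>\<open>x\<close> and \<open>y\<close> appear in row 1 of
      \<open>join2 a s\<close>, since row 0 is occupied by \<open>a\<close>. This is why the
      generators for relations test entries 0 and 1 of row 1.\<close>
    define s where "s k = (if k = (0::nat) then x else y)" for k
    have s: "s \<in> seqs Z" using \<open>x \<in> Z\<close> \<open>y \<in> Z\<close> by (auto simp: seqs_def s_def)
    have "u s t (prod_encode (1, k)) = h t (s k)" for k
      using fun_cong[OF u_Row[OF s t], of k] by simp
    then show "\<exists>s\<in>seqs Z. \<exists>u\<in>supp (c s).
      s (prod_encode (1, 0)) = x \<and> s (prod_encode (1, 1)) = y \<and>
      u (prod_encode (1, 0)) = h t x \<and> u (prod_encode (1, 1)) = h t y"
      using J[OF s] u_mem[OF s t] by (intro bexI[of _ "join2 a s"] bexI[of _ "u s t"]) (simp_all add: s_def)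
  qed
qed

section \<open>The group of a structure\<close>

datatype tag = Val ix | Diag | Act | Rel nat

instance tag :: countable
  by countable_datatype

definition tag_prime :: "tag \<Rightarrow> nat" where
  "tag_prime \<tau> = enumerate {p. prime p} (to_nat \<tau>)"

lemma prime_tag_prime [simp]: "prime (tag_prime \<tau>)"
  using enumerate_in_set[OF primes_infinite] by (simp add: tag_prime_def)

lemma inj_tag_prime: "inj tag_prime"
  unfolding tag_prime_def
  by (intro injI) (metis strict_mono_enumerate[OF primes_infinite] strict_mono_eq to_nat_split)

text \<open>A structure is a set \<open>Z\<close> with binary relations \<open>r 0, r 1, \<dots>\<close>. Its group is spanned by pairs
  of a sequence in \<open>Z\<close> and an operation; each kind of generator is made divisible by all powers
  of its own prime, and homomorphisms have to respect this divisibility.\<close>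

fun gens :: "'a set \<Rightarrow> (nat \<Rightarrow> 'a rel) \<Rightarrow> tag \<Rightarrow> ((nat \<Rightarrow> 'a) \<times> ix \<Rightarrow> rat) set" where
  "gens Z r (Val i) = {unit_vec (s, i) |s. s \<in> seqs Z}"
| "gens Z r Diag = {unit_vec (s, i) - unit_vec (s, j) |s i j. s \<in> seqs Z}"
| "gens Z r Act = {unit_vec (s, i) - unit_vec (s \<circ> act i, Id) |s i. s \<in> seqs Z}"
| "gens Z r (Rel j) = {unit_vec (s, Id) |s. s \<in> seqs Z \<and>
    (s (prod_encode (1, 0)), s (prod_encode (1, 1))) \<in> r j}"

definition grp :: "'a set \<Rightarrow> (nat \<Rightarrow> 'a rel) \<Rightarrow> ((nat \<Rightarrow> 'a) \<times> ix \<Rightarrow> rat) set" where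
  "grp Z r = divspan tag_prime (gens Z r)"

definition struct_hom :: "'a set \<Rightarrow> (nat \<Rightarrow> 'a rel) \<Rightarrow> 'b set \<Rightarrow> (nat \<Rightarrow> 'b rel) \<Rightarrow> ('a \<Rightarrow> 'b) \<Rightarrow> bool" where
  "struct_hom Z r Z' r' h \<longleftrightarrow> (\<forall>x\<in>Z. h x \<in> Z') \<and>
    (\<forall>j. \<forall>x\<in>Z. \<forall>y\<in>Z. (x, y) \<in> r j \<longrightarrow> (h x, h y) \<in> r' j)"

definition grp_map :: "('a \<Rightarrow> 'b) \<Rightarrow> ((nat \<Rightarrow> 'a) \<times> ix \<Rightarrow> rat) \<Rightarrow> (nat \<Rightarrow> 'b) \<times> ix \<Rightarrow> rat" where
  "grp_map h = push (\<lambda>(s, i). (h \<circ> s, i))"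

lemma finite_supp_diff: "finite (supp v) \<Longrightarrow> finite (supp w) \<Longrightarrow> finite (supp (v - w))"
  by (rule finite_subset[of _ "supp v \<union> supp w"]) (auto simp: supp_def)

lemma finite_supp_gens: "w \<in> gens Z r \<tau> \<Longrightarrow> finite (supp w)"
  by (cases \<tau>) (auto simp: finite_supp_diff)

lemma csum_gens_Ints: "w \<in> gens Z r \<tau> \<Longrightarrow> csum C w \<in> \<int>"
  by (cases \<tau>) (auto simp: csum_diff)

lemma finite_supp_grp: "v \<in> grp Z r \<Longrightarrow> finite (supp v)"
  unfolding grp_def using finite_supp_gens by (rule finite_supp_divspan)

lemma supp_gens: "w \<in> gens Z r \<tau> \<Longrightarrow> supp w \<subseteq> seqs Z \<times> UNIV"
  by (cases \<tau>) (auto simp: supp_def unit_vec_apply of_bool_def split: if_splits)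

lemma supp_grp: "v \<in> grp Z r \<Longrightarrow> supp v \<subseteq> seqs Z \<times> UNIV"
  unfolding grp_def
proof (induction rule: divspan.induct)
  case (step v w \<tau> a n)
  have "supp (v + scale (of_int a / of_nat (tag_prime \<tau>) ^ n) w) \<subseteq> supp v \<union> supp w"
    by (auto simp: supp_def scale_def plus_fun_apply)
  then show ?case using step.IH supp_gens[OF step.hyps(2)] by blast
qed simp

lemma unit_vec_grp: "s \<in> seqs Z \<Longrightarrow> unit_vec (s, i) \<in> grp Z r"
  unfolding grp_def by (rule divspan_gen[of _ _ "Val i"]) auto

lemma grp_add: "v \<in> grp Z r \<Longrightarrow> w \<in> grp Z r \<Longrightarrow> v + w \<in> grp Z r"
  unfolding grp_def by (rule divspan_add)

lemma grp_diff: "v \<in> grp Z r \<Longrightarrow> w \<in> grp Z r \<Longrightarrow> v - w \<in> grp Z r"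
  unfolding grp_def by (rule divspan_diff)

lemma grp_0: "0 \<in> grp Z r"
  unfolding grp_def by (rule divspan.zero)

lemma grp_map_unit_vec [simp]: "grp_map h (unit_vec (s, i)) = unit_vec (h \<circ> s, i)"
  by (simp add: grp_map_def)

lemma grp_map_add:
  "v \<in> grp Z r \<Longrightarrow> w \<in> grp Z r \<Longrightarrow> grp_map h (v + w) = grp_map h v + grp_map h w"
  by (simp add: grp_map_def push_add finite_supp_grp)

lemma additive_on_sum_grp_map:
  "additive_on (grp Z r) (\<lambda>v. \<Sum>t\<in>T. scale (n t) (grp_map (h t) v))"
  unfolding additive_on_def sum.distrib[symmetric] scale_add[symmetric]
  by (auto simp: grp_map_add intro!: sum.cong)

lemma grp_map_gens:
  assumes h: "struct_hom Z r Z' r' h" and w: "w \<in> gens Z r \<tau>"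
  shows "grp_map h w \<in> gens Z' r' \<tau>"
proof -
  have [simp]: "h \<circ> s \<in> seqs Z'" if "s \<in> seqs Z" for s
    using h that by (auto simp: struct_hom_def intro: seqs_map)
  have [simp]: "s k \<in> Z" if "s \<in> seqs Z" for s k
    using that by (auto simp: seqs_def)
  have *: "grp_map h (unit_vec x - unit_vec y) = grp_map h (unit_vec x) - grp_map h (unit_vec y)" for x y
    by (simp add: grp_map_def push_diff)
  show ?thesis
  proof (cases \<tau>)
    case (Rel j)
    with w obtain s where s: "w = unit_vec (s, Id)" "s \<in> seqs Z"
      "(s (prod_encode (1, 0)), s (prod_encode (1, 1))) \<in> r j" by auto
    with h have "(h (s (prod_encode (1, 0))), h (s (prod_encode (1, 1)))) \<in> r' j"
      by (simp add: struct_hom_def)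
    then show ?thesis using s Rel by (auto intro!: exI[of _ "h \<circ> s"])
  next
    case (Val i)
    with w obtain s where "w = unit_vec (s, i)" "s \<in> seqs Z" by auto
    then have "grp_map h w = unit_vec (h \<circ> s, i)" "h \<circ> s \<in> seqs Z'" by simp_all
    then show ?thesis unfolding Val gens.simps by blast
  next
    case Diag
    with w obtain s i j where "w = unit_vec (s, i) - unit_vec (s, j)" "s \<in> seqs Z" by auto
    then have "grp_map h w = unit_vec (h \<circ> s, i) - unit_vec (h \<circ> s, j)" "h \<circ> s \<in> seqs Z'"
      by (simp_all add: *)
    then show ?thesis unfolding Diag gens.simps by blast
  next
    case Act
    with w obtain s i where "w = unit_vec (s, i) - unit_vec (s \<circ> act i, Id)" "s \<in> seqs Z" by auto
    then have "grp_map h w = unit_vec (h \<circ> s, i) - unit_vec ((h \<circ> s) \<circ> act i, Id)" "h \<circ> s \<in> seqs Z'"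
      by (simp_all add: * comp_assoc)
    then show ?thesis unfolding Act gens.simps by blast
  qed
qed

lemma grp_map_grp:
  assumes "struct_hom Z r Z' r' h" "v \<in> grp Z r"
  shows "grp_map h v \<in> grp Z' r'"
  using assms(2) unfolding grp_def
proof (induction rule: divspan.induct)
  case zero
  show ?case by (simp add: grp_map_def divspan.zero)
next
  case (step v w \<tau> a n)
  have "finite (supp v)" using step.hyps(1) by (auto simp: finite_supp_grp[unfolded grp_def])
  moreover have "finite (supp w)" using step.hyps(2) by (rule finite_supp_gens)
  ultimately have "grp_map h (v + scale (of_int a / of_nat (tag_prime \<tau>) ^ n) w) =
      grp_map h v + scale (of_int a / of_nat (tag_prime \<tau>) ^ n) (grp_map h w)"
    by (simp add: grp_map_def push_add push_scale finite_supp_scale)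
  then show ?case
    by (simp only: divspan.step[OF step.IH grp_map_gens[OF assms(1) step.hyps(2)]])
qed

lemma grp_map_comp:
  assumes "v \<in> grp Z r"
  shows "grp_map h' (grp_map h v) = grp_map (h' \<circ> h) v"
proof -
  obtain A N where v: "v = (\<Sum>x\<in>A. scale (N x) (unit_vec x))"
    using sum_unit_vec[OF finite_supp_grp[OF assms]] by blast
  show ?thesis
    unfolding v by (simp add: grp_map_def push_sum_unit_vec split_def comp_assoc)
qed

lemma grp_map_cong:
  assumes "\<And>x. x \<in> Z \<Longrightarrow> h x = h' x" "v \<in> grp Z r"
  shows "grp_map h v = grp_map h' v"
proof -
  obtain A N where A: "A = supp v" and v: "v = (\<Sum>x\<in>A. scale (N x) (unit_vec x))"
    using sum_unit_vec[OF finite_supp_grp[OF assms(2)]] by blast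
  have "h \<circ> fst x = h' \<circ> fst x" if "x \<in> A" for x
    using that supp_grp[OF assms(2)] assms(1) unfolding A by (fastforce simp: seqs_def fun_eq_iff)
  then show ?thesis
    unfolding v grp_map_def push_sum_unit_vec by (intro sum.cong) (simp_all add: split_def)
qed

lemma csum_column:
  assumes "\<And>t j. j \<noteq> i \<Longrightarrow> v (t, j) = 0"
  shows "csum C v = csum {t. (t, i) \<in> C} (\<lambda>t. v (t, i))"
proof -
  have "C \<inter> supp v = (\<lambda>t. (t, i)) ` ({t. (t, i) \<in> C} \<inter> supp (\<lambda>t. v (t, i)))"
    using assms by (auto simp: supp_def image_iff) metis+
  then show ?thesis by (simp add: csum_def sum.reindex inj_on_def)
qed

text \<open>Each tag contributes a constraint through functionals that kill its generators.
  \<open>Val i\<close> keeps the image of column \<open>i\<close> inside column \<open>i\<close>,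
  \<open>Diag\<close> gives all columns the same coefficients \<open>c s\<close>, \<open>Act\<close>
  makes \<open>c\<close> equivariant so that \<open>coherent_family\<close> applies, and
  \<open>Rel j\<close> makes the resulting point maps preserve relation \<open>j\<close>.\<close>

theorem grp_hom_expansion:
  fixes \<phi> :: "((nat \<Rightarrow> 'a) \<times> ix \<Rightarrow> rat) \<Rightarrow> (nat \<Rightarrow> 'b) \<times> ix \<Rightarrow> rat"
  assumes Z: "Z \<noteq> {}" and \<phi>: "additive_on (grp Z r) \<phi>" and im: "\<phi> ` grp Z r \<subseteq> grp Z' r'"
  obtains T n h where "finite (T :: (nat \<Rightarrow> 'b) set)" "\<And>t. t \<in> T \<Longrightarrow> n t \<in> \<int>"
    "\<And>t. t \<in> T \<Longrightarrow> struct_hom Z r Z' r' (h t)"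
    "\<And>v. v \<in> grp Z r \<Longrightarrow> \<phi> v = (\<Sum>t\<in>T. scale (n t) (grp_map (h t) v))"
proof -
  let ?e0 = "prod_encode (1, 0)" and ?e1 = "prod_encode (1, 1)"
  define c where "c s t = \<phi> (unit_vec (s, Id)) (t, Id)" for s t
  have kill: "csum C (\<phi> w) = 0"
    if "\<And>w. w \<in> gens Z' r' \<tau> \<Longrightarrow> csum C w = 0" "w \<in> gens Z r \<tau>" for C w \<tau>
    by (rule additive_on_kills[OF finite_supp_gens csum_gens_Ints prime_tag_prime inj_tag_prime that(1)
        \<phi>[unfolded grp_def] im[unfolded grp_def] that(2)])
  have fin: "finite (supp (\<phi> (unit_vec (s, i))))" if "s \<in> seqs Z" for s i
    using im unit_vec_grp[OF that] finite_supp_grp by blast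
  have \<phi>_diff: "\<phi> (unit_vec (s, i) - unit_vec (s', j)) = \<phi> (unit_vec (s, i)) - \<phi> (unit_vec (s', j))"
    if "s \<in> seqs Z" "s' \<in> seqs Z" for s s' i j
    using additive_on_diff[OF \<phi>[unfolded grp_def]] unit_vec_grp[OF that(1)] unit_vec_grp[OF that(2)]
    unfolding grp_def by blast
  have off: "\<phi> (unit_vec (s, i)) (t, j) = 0" if "s \<in> seqs Z" "j \<noteq> i" for s i t j
  proof -
    have "csum {(t, j)} (\<phi> (unit_vec (s, i))) = 0"
      by (rule kill[of "Val i"]) (use that in \<open>auto simp: unit_vec_apply\<close>)
    then show ?thesis by simp
  qed
  have col: "csum C (\<phi> (unit_vec (s, i))) = csum {t. (t, i) \<in> C} (\<lambda>t. \<phi> (unit_vec (s, i)) (t, i))"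
    if "s \<in> seqs Z" for C s i
    by (rule csum_column) (use off that in blast)
  have diag: "\<phi> (unit_vec (s, i)) (t, i) = c s t" if s: "s \<in> seqs Z" for s i t
  proof -
    let ?C = "{x. fst x = t}"
    have "csum ?C (\<phi> (unit_vec (s, i) - unit_vec (s, Id))) = 0"
      by (rule kill[of Diag]) (use s in \<open>auto simp: csum_diff\<close>)
    then have "csum ?C (\<phi> (unit_vec (s, i))) = csum ?C (\<phi> (unit_vec (s, Id)))"
      using s by (simp add: \<phi>_diff csum_diff fin)
    then show ?thesis unfolding col[OF s] by (simp add: c_def)
  qed
  have val: "\<phi> (unit_vec (s, i)) (t, j) = (if j = i then c s t else 0)" if "s \<in> seqs Z" for s i t j
    using off diag that by simp
  have col': "csum C (\<phi> (unit_vec (s, i))) = csum {t. (t, i) \<in> C} (c s)" if "s \<in> seqs Z" for C s i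
    using col[OF that] by (simp add: diag[OF that])
  have fin_c: "finite (supp (c s))" if "s \<in> seqs Z" for s
  proof (rule finite_subset[OF _ finite_imageI[OF fin[OF that, of Id], of fst]])
    show "supp (c s) \<subseteq> fst ` supp (\<phi> (unit_vec (s, Id)))" by (force simp: supp_def c_def)
  qed
  have push: "c (s \<circ> act m) = push (\<lambda>t. t \<circ> act m) (c s)" if s: "s \<in> seqs Z" for s m
  proof
    fix t0 :: "nat \<Rightarrow> 'b"
    \<comment> \<open>The functional carries out the operation recorded in the second component
      before comparing with \<open>t0\<close>, so it has the same value on both terms of an
      \<open>Act\<close> generator.\<close>
    let ?C = "{x. fst x \<circ> act (snd x) = t0}"
    have "csum ?C (\<phi> (unit_vec (s, m) - unit_vec (s \<circ> act m, Id))) = 0"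
      by (rule kill[of Act]) (use s in \<open>auto simp: csum_diff\<close>)
    then have "csum ?C (\<phi> (unit_vec (s, m))) = csum ?C (\<phi> (unit_vec (s \<circ> act m, Id)))"
      using s by (simp add: \<phi>_diff csum_diff fin)
    then show "c (s \<circ> act m) t0 = push (\<lambda>t. t \<circ> act m) (c s) t0"
      using s by (simp add: col' push_def vimage_def)
  qed
  have int: "c s t \<in> \<int>" if s: "s \<in> seqs Z" for s t
  proof (rule integral_at_all_imp_Ints)
    fix p :: nat assume p: "prime p"
    \<comment> \<open>A functional is needed that vanishes on the generators divisible by powers of
      \<open>p\<close> and still reads off \<open>c s t\<close>. For \<open>Val\<close> and
      \<open>Rel\<close> a column other than the divisible one serves, as all columns carry the same
      coefficients; for \<open>Diag\<close> and \<open>Act\<close> the two terms of a generator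
      cancel.\<close>
    have "\<exists>C i. csum C (\<phi> (unit_vec (s, i))) = c s t \<and>
      (\<forall>\<tau> w. tag_prime \<tau> = p \<longrightarrow> w \<in> gens Z' r' \<tau> \<longrightarrow> csum C w = 0)"
    proof (cases "p \<in> range tag_prime")
      case False
      then show ?thesis by (intro exI[of _ "{(t, Id)}"] exI[of _ Id]) (auto simp: c_def)
    next
      case True
      then obtain \<sigma> where \<sigma>: "p = tag_prime \<sigma>" by blast
      then have eq: "\<tau> = \<sigma>" if "tag_prime \<tau> = p" for \<tau> using inj_tag_prime that by (simp add: injD)
      show ?thesis
      proof (cases \<sigma>)
        case (Val i)
        obtain j where j: "j \<noteq> i" by (metis ix.distinct(1))
        have "csum {(t, j)} w = 0" if "tag_prime \<tau> = p" "w \<in> gens Z' r' \<tau>" for \<tau> w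
          using that(2) eq[OF that(1)] Val j by (auto simp: unit_vec_apply)
        moreover have "csum {(t, j)} (\<phi> (unit_vec (s, j))) = c s t" using s by (simp add: val)
        ultimately show ?thesis by blast
      next
        case Diag
        have "csum {x. fst x = t} w = 0" if "tag_prime \<tau> = p" "w \<in> gens Z' r' \<tau>" for \<tau> w
          using that(2) eq[OF that(1)] Diag by (auto simp: csum_diff)
        moreover have "csum {x. fst x = t} (\<phi> (unit_vec (s, Id))) = c s t"
          using s by (simp add: col')
        ultimately show ?thesis by blast
      next
        case Act
        have "csum {x. fst x \<circ> act (snd x) = t} w = 0" if "tag_prime \<tau> = p" "w \<in> gens Z' r' \<tau>" for \<tau> w
          using that(2) eq[OF that(1)] Act by (auto simp: csum_diff)
        moreover have "csum {x. fst x \<circ> act (snd x) = t} (\<phi> (unit_vec (s, Id))) = c s t"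
          using s by (simp add: col')
        ultimately show ?thesis by blast
      next
        case (Rel j)
        have "csum {(t, Row 0)} w = 0" if "tag_prime \<tau> = p" "w \<in> gens Z' r' \<tau>" for \<tau> w
          using that(2) eq[OF that(1)] Rel by (auto simp: unit_vec_apply)
        moreover have "csum {(t, Row 0)} (\<phi> (unit_vec (s, Row 0))) = c s t"
          using s by (simp add: val)
        ultimately show ?thesis by blast
      qed
    qed
    then obtain C i where C: "csum C (\<phi> (unit_vec (s, i))) = c s t"
      and kills: "\<And>\<tau> w. tag_prime \<tau> = p \<Longrightarrow> w \<in> gens Z' r' \<tau> \<Longrightarrow> csum C w = 0" by blast
    have "\<phi> (unit_vec (s, i)) \<in> divspan tag_prime (gens Z' r')"
      using im unit_vec_grp[OF s] unfolding grp_def by blast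
    then have "integral_at p (csum C (\<phi> (unit_vec (s, i))))"
      by (rule divspan_integral_at[where g = "gens Z' r'" and p = tag_prime, rotated -1])
        (use finite_supp_gens csum_gens_Ints p kills in auto)
    then show "integral_at p (c s t)" unfolding C .
  qed
  have rel: "(u ?e0, u ?e1) \<in> r' j"
    if s: "s \<in> seqs Z" and e: "(s ?e0, s ?e1) \<in> r j" and u: "u \<in> supp (c s)" for s u j
  proof (rule ccontr)
    assume not: "(u ?e0, u ?e1) \<notin> r' j"
    have "csum {(u, Id)} (\<phi> (unit_vec (s, Id))) = 0"
    proof (rule kill[of "Rel j"])
      show "unit_vec (s, Id) \<in> gens Z r (Rel j)" using s e by auto
      show "csum {(u, Id)} w = 0" if "w \<in> gens Z' r' (Rel j)" for w
        using that not by (auto simp: unit_vec_apply)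
    qed
    then show False using u by (simp add: c_def supp_def)
  qed
  have range: "u k \<in> Z'" if s: "s \<in> seqs Z" and u: "u \<in> supp (c s)" for s u k
  proof -
    have "(u, Id) \<in> supp (\<phi> (unit_vec (s, Id)))" using u by (simp add: c_def supp_def)
    moreover have "\<phi> (unit_vec (s, Id)) \<in> grp Z' r'" using im unit_vec_grp[OF s] by blast
    ultimately show ?thesis using supp_grp by (fastforce simp: seqs_def)
  qed
  obtain T n h where T: "finite T"
    and c: "\<And>s. s \<in> seqs Z \<Longrightarrow> c s = (\<Sum>t\<in>T. scale (n t) (unit_vec (h t \<circ> s)))"
    and n: "\<And>t. t \<in> T \<Longrightarrow> \<exists>s\<in>seqs Z. n t = c s t"
    and h: "\<And>t x y. t \<in> T \<Longrightarrow> x \<in> Z \<Longrightarrow> y \<in> Z \<Longrightarrow> \<exists>s\<in>seqs Z. \<exists>u\<in>supp (c s).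
      s ?e0 = x \<and> s ?e1 = y \<and> u ?e0 = h t x \<and> u ?e1 = h t y"
    using coherent_family[of Z c] Z fin_c push by blast
  show ?thesis
  proof (rule that[of T n h])
    show "finite T" by (rule T)
    show "n t \<in> \<int>" if "t \<in> T" for t using n[OF that] int by auto
    show "struct_hom Z r Z' r' (h t)" if t: "t \<in> T" for t
      unfolding struct_hom_def
    proof (intro conjI ballI allI impI)
      fix x assume "x \<in> Z"
      then show "h t x \<in> Z'" using h[OF t, of x x] range by metis
      fix y j assume "y \<in> Z" "(x, y) \<in> r j"
      then show "(h t x, h t y) \<in> r' j" using h[OF t \<open>x \<in> Z\<close> \<open>y \<in> Z\<close>] rel by metis
    qed
    fix v assume v: "v \<in> grp Z r"
    let ?\<psi> = "\<lambda>v. \<Sum>t\<in>T. scale (n t) (grp_map (h t) v)"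
    have \<psi>_add: "additive_on (grp Z r) ?\<psi>"
      by (rule additive_on_sum_grp_map)
    have unit: "\<phi> (unit_vec (s, i)) = ?\<psi> (unit_vec (s, i))" if s: "s \<in> seqs Z" for s i
    proof
      fix x :: "(nat \<Rightarrow> 'b) \<times> ix"
      obtain t j where x: "x = (t, j)" by fastforce
      have "\<phi> (unit_vec (s, i)) (t, j) = (if j = i then c s t else 0)" using s by (rule val)
      also have "\<dots> = ?\<psi> (unit_vec (s, i)) (t, j)"
        by (auto simp: c[OF s] sum_fun_apply scale_def unit_vec_apply intro!: sum.cong)
      finally show "\<phi> (unit_vec (s, i)) x = ?\<psi> (unit_vec (s, i)) x" unfolding x .
    qed
    have \<psi>_diff: "?\<psi> (unit_vec x - unit_vec y) = ?\<psi> (unit_vec x) - ?\<psi> (unit_vec y)" for x y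
      by (simp add: grp_map_def push_diff scale_diff sum_subtractf)
    have "\<phi> w = ?\<psi> w" if "w \<in> gens Z r \<tau>" for w \<tau>
      using that by (cases \<tau>) (auto simp only: gens.simps mem_Collect_eq \<phi>_diff \<psi>_diff unit seqs_comp)
    then show "\<phi> v = ?\<psi> v"
      using additive_on_divspan_cong[OF \<phi>[unfolded grp_def] \<psi>_add[unfolded grp_def] prime_tag_prime]
        v unfolding grp_def by blast
  qed
qed

text \<open>The maps \<open>k h\<close> differ at finitely many points, hence along a single sequence.\<close>

lemma grp_map_independent:
  assumes Z: "Z \<noteq> {}" and H: "finite H" and inj: "inj_on (\<lambda>h. restrict (k h) Z) H"
    and zero: "\<And>v. v \<in> grp Z r \<Longrightarrow> (\<Sum>h\<in>H. scale (N h) (grp_map (k h) v)) = 0"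
    and h: "h \<in> H"
  shows "N h = 0"
proof -
  obtain z where z: "z \<in> Z" using Z by blast
  have "\<exists>x\<in>Z. f \<in> H \<longrightarrow> g \<in> H \<longrightarrow> f \<noteq> g \<longrightarrow> k f x \<noteq> k g x" for f g
  proof (cases "f \<in> H \<and> g \<in> H \<and> f \<noteq> g")
    case True
    then have "restrict (k f) Z \<noteq> restrict (k g) Z" using inj by (auto dest: inj_onD)
    then obtain x where "restrict (k f) Z x \<noteq> restrict (k g) Z x" by (auto simp: fun_eq_iff)
    then show ?thesis by (intro bexI[of _ x]) (auto simp: restrict_def split: if_splits)
  qed (use z in blast)
  then obtain d where d: "\<And>f g. d f g \<in> Z"
    "\<And>f g. f \<in> H \<Longrightarrow> g \<in> H \<Longrightarrow> f \<noteq> g \<Longrightarrow> k f (d f g) \<noteq> k g (d f g)" by metis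
  let ?P = "insert z ((\<lambda>(f, g). d f g) ` (H \<times> H))"
  define s where "s = from_nat_into ?P"
  have range: "range s = ?P"
    unfolding s_def using H by (intro range_from_nat_into) (auto intro: countable_finite)
  then have s: "s \<in> seqs Z" using d(1) z by (auto simp: seqs_def)
  have sep: "f = h" if "f \<in> H" "k f \<circ> s = k h \<circ> s" for f
  proof (rule ccontr)
    assume "f \<noteq> h"
    moreover have "d f h \<in> range s" unfolding range using that h by force
    ultimately show False using d(2)[OF that(1) h] that(2) by (auto simp: fun_eq_iff)
  qed
  \<comment> \<open>At the basis vector of \<open>s\<close>, only the summand of \<open>h\<close>
    has a nonzero coordinate at the composition of \<open>k h\<close> with \<open>s\<close>, because
    \<open>s\<close> separates the members of \<open>H\<close>.\<close>
  have "(\<Sum>f\<in>H. scale (N f) (grp_map (k f) (unit_vec (s, Id)))) (k h \<circ> s, Id) = (\<Sum>f\<in>H. if f = h then N f else 0)"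
    unfolding sum_fun_apply by (intro sum.cong) (auto simp: scale_def unit_vec_apply dest: sep)
  also have "\<dots> = N h" using H h by simp
  finally show ?thesis using zero[OF unit_vec_grp[OF s]] by (simp add: zero_fun_apply)
qed

section \<open>Small sets\<close>

text \<open>Smallness for sets over types other than \<open>'v\<close>, such as sequences, vectors
  and functions, by means of an injective coding into the universe.\<close>

definition sized :: "('v \<Rightarrow> 'v set) \<Rightarrow> 'b set \<Rightarrow> bool" where
  "sized elts S \<longleftrightarrow> (\<exists>c::'b \<Rightarrow> 'v. inj_on c S \<and> small elts (c ` S))"

definition set_code :: "('v \<Rightarrow> 'v set) \<Rightarrow> 'b set \<Rightarrow> 'b \<Rightarrow> 'v" where
  "set_code elts S = (SOME c. inj_on c S \<and> small elts (c ` S))"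

lemma inj_small_code:
  assumes "sized elts S"
  shows "inj_on (set_code elts S) S \<and> small elts (set_code elts S ` S)"
  unfolding set_code_def by (rule someI_ex[OF assms[unfolded sized_def]])

lemma small_iff: "small elts S \<longleftrightarrow> (\<exists>x. elts x = S)"
  by (auto simp: small_def)

lemma small_elts [simp]: "small elts (elts x)"
  by (simp add: small_def)

context zfc_universe
begin

lemma small_subset:
  assumes "small elts S" "T \<subseteq> S"
  shows "small elts T"
proof -
  obtain x where "elts x = S" using assms(1) unfolding small_iff by blast
  then show ?thesis using separation[of T x] assms(2) by (simp add: small_iff)
qed

lemma small_image:
  assumes "small elts S"
  shows "small elts (F ` S)"
proof -
  obtain x where "elts x = S" using assms unfolding small_iff by blast
  then show ?thesis using replacement[of F x] by (simp add: small_iff)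
qed

lemma sizedI: "inj_on c S \<Longrightarrow> c ` S \<subseteq> T \<Longrightarrow> small elts T \<Longrightarrow> sized elts S"
  unfolding sized_def using small_subset by blast

lemma sized_iff_small: "sized elts S \<longleftrightarrow> small elts S" for S :: "'v set"
proof
  assume "sized elts S"
  then obtain c where c: "inj_on c S" "small elts (c ` S)" unfolding sized_def by blast
  have "inv_into S c ` c ` S = S" using c(1) by (simp add: inv_into_image_cancel)
  then show "small elts S" using small_image[OF c(2), of "inv_into S c"] by simp
next
  show "small elts S \<Longrightarrow> sized elts S" by (rule sizedI[of "\<lambda>x. x"]) auto
qed

lemma sized_inj: "inj_on f S \<Longrightarrow> f ` S \<subseteq> T \<Longrightarrow> sized elts T \<Longrightarrow> sized elts S"
proof -
  assume f: "inj_on f S" "f ` S \<subseteq> T" and "sized elts T"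
  then obtain c :: "_ \<Rightarrow> 'v" where c: "inj_on c T" "small elts (c ` T)" unfolding sized_def by blast
  show "sized elts S"
    by (rule sizedI[of "c \<circ> f" _ "c ` T"])
      (use f c in \<open>auto intro: comp_inj_on inj_on_subset\<close>)
qed

lemma sized_subset: "sized elts T \<Longrightarrow> S \<subseteq> T \<Longrightarrow> sized elts S"
  by (rule sized_inj[of "\<lambda>x. x"]) auto

lemma small_UN:
  fixes X :: "'k \<Rightarrow> 'v set"
  assumes "sized elts K" "\<And>k. k \<in> K \<Longrightarrow> small elts (X k)"
  shows "small elts (\<Union>k\<in>K. X k)"
proof -
  obtain c :: "'k \<Rightarrow> 'v" where c: "inj_on c K" "small elts (c ` K)"
    using assms(1) unfolding sized_def by blast
  obtain w where w: "\<And>k. k \<in> K \<Longrightarrow> elts (w k) = X k"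
    using assms(2) unfolding small_iff by metis
  have "w ` K = (w \<circ> inv_into K c) ` c ` K" using c(1) by (force simp: image_iff)
  then have "small elts (w ` K)" using small_image[OF c(2)] by simp
  then obtain u where "elts u = w ` K" unfolding small_iff by auto
  moreover obtain z where "elts z = (\<Union>y\<in>elts u. elts y)" using union by blast
  ultimately have "elts z = (\<Union>k\<in>K. X k)" using w by auto
  then show ?thesis unfolding small_iff by blast
qed

lemma sized_Times:
  assumes "sized elts S" "sized elts T"
  shows "sized elts (S \<times> T)"
proof -
  obtain c :: "_ \<Rightarrow> 'v" where c: "inj_on c S" "small elts (c ` S)"
    using assms(1) unfolding sized_def by blast
  obtain d :: "_ \<Rightarrow> 'v" where d: "inj_on d T" "small elts (d ` T)"
    using assms(2) unfolding sized_def by blast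
  obtain Q where Q: "\<And>x y. elts (Q x y) = {x, y}" using pairing by metis
  \<comment> \<open>The Kuratowski pair.\<close>
  define P where "P x y = Q (Q x x) (Q x y)" for x y
  have P_inj: "x = x' \<and> y = y'" if "P x y = P x' y'" for x y x' y'
  proof -
    have "{Q x x, Q x y} = {Q x' x', Q x' y'}"
      using that Q[of "Q x x" "Q x y"] Q[of "Q x' x'" "Q x' y'"] unfolding P_def by simp
    then have "elts ` {Q x x, Q x y} = elts ` {Q x' x', Q x' y'}" by (rule arg_cong)
    then have "{{x, x}, {x, y}} = {{x', x'}, {x', y'}}" by (simp add: Q)
    then show ?thesis by (auto simp: doubleton_eq_iff)
  qed
  have inj: "inj_on (\<lambda>(x, y). P (c x) (d y)) (S \<times> T)"
    by (rule inj_onI) (auto dest!: P_inj dest: inj_onD[OF c(1)] inj_onD[OF d(1)])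
  have "small elts (\<Union>y\<in>T. (\<lambda>x. P (c x) (d y)) ` S)"
  proof (rule small_UN[OF assms(2)])
    fix y
    show "small elts ((\<lambda>x. P (c x) (d y)) ` S)"
      using small_image[OF c(2), of "\<lambda>z. P z (d y)"] by (simp add: image_image)
  qed
  then show ?thesis by (rule sizedI[OF inj, rotated]) auto
qed

lemma sized_Pow:
  assumes "sized elts S"
  shows "sized elts (Pow S)"
proof -
  obtain c :: "_ \<Rightarrow> 'v" where c: "inj_on c S" "small elts (c ` S)"
    using assms unfolding sized_def by blast
  have "\<exists>z. elts z = c ` A" if "A \<subseteq> S" for A
    using small_subset[OF c(2), of "c ` A"] that unfolding small_iff by blast
  then obtain w where w: "\<And>A. A \<subseteq> S \<Longrightarrow> elts (w A) = c ` A" by metis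
  obtain x where x: "elts x = c ` S" using c(2) unfolding small_iff by auto
  obtain z where z: "elts z = {y. elts y \<subseteq> elts x}" using powerset by blast
  show ?thesis
  proof (rule sizedI[of w _ "elts z"])
    show "inj_on w (Pow S)"
      by (rule inj_onI) (metis Pow_iff c(1) inj_on_image_eq_iff w)
    show "w ` Pow S \<subseteq> elts z" using w by (fastforce simp: z x)
    show "small elts (elts z)" by simp
  qed
qed

text \<open>The prescribed value outside \<open>S\<close> lets the graph over \<open>S\<close>
  determine the function. The form covers \<open>PiE\<close> (default \<open>undefined\<close>),
  vectors supported in \<open>S\<close> (default 0) and sequences (every index lies in
  \<open>S\<close>).\<close>

lemma sized_functions:
  assumes "sized elts S" "sized elts T"
  shows "sized elts {f. \<forall>x. if x \<in> S then f x \<in> T else f x = d}"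
proof (rule sized_inj[of "\<lambda>f. (\<lambda>x. (x, f x)) ` S"])
  show "sized elts (Pow (S \<times> T))" using assms by (intro sized_Pow sized_Times)
  show "inj_on (\<lambda>f. (\<lambda>x. (x, f x)) ` S) {f. \<forall>x. if x \<in> S then f x \<in> T else f x = d}"
  proof (rule inj_onI, rule ext)
    fix f g x
    assume *: "f \<in> {f. \<forall>x. if x \<in> S then f x \<in> T else f x = d}"
      "g \<in> {f. \<forall>x. if x \<in> S then f x \<in> T else f x = d}"
      "(\<lambda>x. (x, f x)) ` S = (\<lambda>x. (x, g x)) ` S"
    show "f x = g x"
    proof (cases "x \<in> S")
      case True
      then have "(x, f x) \<in> (\<lambda>x. (x, g x)) ` S" using *(3) by blast
      then show ?thesis by auto
    next
      case False
      then show ?thesis using *(1,2)[unfolded mem_Collect_eq, THEN spec, of x] by simp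
    qed
  qed
qed auto

lemma sized_PiE:
  assumes "sized elts S" "sized elts T"
  shows "sized elts (S \<rightarrow>\<^sub>E T)"
  by (rule sized_subset[OF sized_functions[OF assms, of undefined]]) (auto simp: PiE_iff extensional_def)

lemma sized_countable: "sized elts (UNIV :: 'c::countable set)"
proof -
  obtain x where "infinite (elts x)" using infinity by blast
  then obtain f :: "nat \<Rightarrow> 'v" where f: "inj f" "range f \<subseteq> elts x"
    using infinite_countable_subset by blast
  show ?thesis
    by (rule sizedI[of "f \<circ> to_nat" _ "elts x"])
      (use f in \<open>auto simp: inj_compose small_def\<close>)
qed

lemma sized_Plus:
  assumes "sized elts S" "sized elts T"
  shows "sized elts (S <+> T)"
proof -
  obtain c :: "_ \<Rightarrow> 'v" where c: "inj_on c S" "small elts (c ` S)"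
    using assms(1) unfolding sized_def by blast
  obtain d :: "_ \<Rightarrow> 'v" where d: "inj_on d T" "small elts (d ` T)"
    using assms(2) unfolding sized_def by blast
  have "small elts (\<Union>b\<in>UNIV. if b then c ` S else d ` T)"
    using c d by (intro small_UN sized_countable) simp
  then have sized: "sized elts ((\<Union>b\<in>UNIV. if b then c ` S else d ` T) \<times> (UNIV :: bool set))"
    unfolding sized_iff_small[symmetric] using sized_countable by (rule sized_Times)
  let ?e = "case_sum (\<lambda>x. (c x, True)) (\<lambda>x. (d x, False))"
  have "inj_on ?e (S <+> T)"
    by (rule inj_onI) (auto dest: inj_onD[OF c(1)] inj_onD[OF d(1)])
  moreover have "?e ` (S <+> T) \<subseteq> (\<Union>b\<in>UNIV. if b then c ` S else d ` T) \<times> UNIV"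
    by (auto simp: UNIV_bool)
  ultimately show ?thesis using sized by (rule sized_inj)
qed

lemma sized_seqs: "sized elts Z \<Longrightarrow> sized elts (seqs Z)"
  by (rule sized_subset[OF sized_functions[OF sized_countable]]) (auto simp: seqs_def)

lemma sized_grp:
  assumes "sized elts Z"
  shows "sized elts (grp Z r)"
proof (rule sized_subset)
  show "sized elts {v. \<forall>x. if x \<in> seqs Z \<times> (UNIV :: ix set) then v x \<in> (UNIV :: rat set) else v x = 0}"
    using assms by (intro sized_functions sized_Times sized_seqs sized_countable)
  show "grp Z r \<subseteq> {v. \<forall>x. if x \<in> seqs Z \<times> (UNIV :: ix set) then v x \<in> (UNIV :: rat set) else v x = 0}"
    using supp_grp by (fastforce simp: supp_def)
qed

end

section \<open>The functor from graphs to abelian groups\<close>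

definition graph_pts :: "'v graph \<Rightarrow> 'v option set" where
  "graph_pts X = insert None (Some ` fst X)"

text \<open>The base point \<open>None\<close> keeps the group of the empty graph nontrivial.\<close>

definition graph_rels :: "'v graph \<Rightarrow> nat \<Rightarrow> 'v option rel" where
  "graph_rels X j = (if j = 0 then map_prod Some Some ` snd X
    else if j = 1 then {(None, None)} else Id_on (range Some))"

definition graph_grp :: "'v graph \<Rightarrow> ((nat \<Rightarrow> 'v option) \<times> ix \<Rightarrow> rat) set" where
  "graph_grp X = grp (graph_pts X) (graph_rels X)"

lemma graph_homD:
  assumes "f \<in> graph_hom X Y"
  shows "f \<in> extensional (fst X)" "x \<in> fst X \<Longrightarrow> f x \<in> fst Y" "(x, y) \<in> snd X \<Longrightarrow> (f x, f y) \<in> snd Y"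
  using assms by (cases X; cases Y; force simp: PiE_iff)+

lemma graph_homI:
  assumes "f \<in> extensional (fst X)" "\<And>x. x \<in> fst X \<Longrightarrow> f x \<in> fst Y"
    "\<And>x y. (x, y) \<in> snd X \<Longrightarrow> (f x, f y) \<in> snd Y"
  shows "f \<in> graph_hom X Y"
  using assms by (cases X; cases Y) (auto simp: PiE_iff)

lemma struct_hom_graph_hom:
  assumes "f \<in> graph_hom X Y"
  shows "struct_hom (graph_pts X) (graph_rels X) (graph_pts Y) (graph_rels Y) (map_option f)"
  using graph_homD[OF assms] by (auto simp: struct_hom_def graph_pts_def graph_rels_def)

text \<open>Relation 1 forces the base point to be fixed, relation 2 keeps the proper points away
  from it, and relation 0 carries the edges. Nothing beyond a graph map is left.\<close>

lemma graph_hom_struct_hom: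
  assumes X: "snd X \<subseteq> fst X \<times> fst X"
    and h: "struct_hom (graph_pts X) (graph_rels X) (graph_pts Y) (graph_rels Y) h"
  shows "\<exists>f\<in>graph_hom X Y. \<forall>z\<in>graph_pts X. h z = map_option f z"
proof -
  have pts: "h z \<in> graph_pts Y" if "z \<in> graph_pts X" for z
    using h that by (simp add: struct_hom_def)
  have rels: "(h z, h z') \<in> graph_rels Y j"
    if "z \<in> graph_pts X" "z' \<in> graph_pts X" "(z, z') \<in> graph_rels X j" for z z' j
    using h that by (simp add: struct_hom_def)
  have None: "h None = None"
    using rels[of None None 1] by (simp add: graph_pts_def graph_rels_def)
  have Some: "\<exists>y\<in>fst Y. h (Some x) = Some y" if "x \<in> fst X" for x
    using rels[of "Some x" "Some x" 2] pts[of "Some x"] that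
    by (auto simp: graph_pts_def graph_rels_def Id_on_iff)
  define f where "f = (\<lambda>x\<in>fst X. the (h (Some x)))"
  have f: "h (Some x) = Some (f x)" "f x \<in> fst Y" if "x \<in> fst X" for x
    using Some[OF that] that by (auto simp: f_def)
  have "f \<in> graph_hom X Y"
  proof (rule graph_homI)
    fix x y assume xy: "(x, y) \<in> snd X"
    then have "x \<in> fst X" "y \<in> fst X" using X by auto
    then have "(h (Some x), h (Some y)) \<in> graph_rels Y 0"
      using xy by (intro rels) (auto simp: graph_pts_def graph_rels_def)
    then show "(f x, f y) \<in> snd Y"
      by (auto simp: graph_rels_def f(1)[OF \<open>x \<in> fst X\<close>] f(1)[OF \<open>y \<in> fst X\<close>])
  next
    show "f \<in> extensional (fst X)" by (simp add: f_def)
  qed (rule f(2))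
  moreover have "\<forall>z\<in>graph_pts X. h z = map_option f z"
    by (auto simp: graph_pts_def f(1) None)
  ultimately show ?thesis by blast
qed

lemma graph_grp_map: "f \<in> graph_hom X Y \<Longrightarrow> v \<in> graph_grp X \<Longrightarrow> grp_map (map_option f) v \<in> graph_grp Y"
  unfolding graph_grp_def by (rule grp_map_grp[OF struct_hom_graph_hom])

lemma graph_grp_map_compose:
  assumes "v \<in> graph_grp A"
  shows "grp_map (map_option g) (grp_map (map_option f) v) = grp_map (map_option (compose (fst A) g f)) v"
proof -
  have "grp_map (map_option g) (grp_map (map_option f) v) = grp_map (map_option g \<circ> map_option f) v"
    using assms unfolding graph_grp_def by (rule grp_map_comp)
  also have "\<dots> = grp_map (map_option (compose (fst A) g f)) v"
    using assms unfolding graph_grp_def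
    by (rule grp_map_cong[rotated]) (auto simp: graph_pts_def compose_def)
  finally show ?thesis .
qed

text \<open>The spanning half of the freeness of hom-groups; \<open>grp_map_independent\<close> is
  the other half.\<close>

lemma graph_grp_hom_expansion:
  assumes X: "snd X \<subseteq> fst X \<times> fst X"
    and \<phi>: "additive_on (graph_grp X) \<phi>" "\<phi> ` graph_grp X \<subseteq> graph_grp Y"
  shows "\<exists>H N. finite H \<and> H \<subseteq> graph_hom X Y \<and> (\<forall>f\<in>H. N f \<in> \<int>) \<and>
    (\<forall>v\<in>graph_grp X. \<phi> v = (\<Sum>f\<in>H. scale (N f) (grp_map (map_option f) v)))"
proof -
  \<comment> \<open>The base point makes the expansion theorem applicable to the empty graph as
    well.\<close>
  have pts: "graph_pts X \<noteq> {}" by (simp add: graph_pts_def)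
  obtain T :: "(nat \<Rightarrow> 'a option) set" and n h where T: "finite T" "\<And>t. t \<in> T \<Longrightarrow> n t \<in> \<int>"
    and h: "\<And>t. t \<in> T \<Longrightarrow> struct_hom (graph_pts X) (graph_rels X) (graph_pts Y) (graph_rels Y) (h t)"
    and \<phi>_eq: "\<And>v. v \<in> graph_grp X \<Longrightarrow> \<phi> v = (\<Sum>t\<in>T. scale (n t) (grp_map (h t) v))"
    using grp_hom_expansion[OF pts \<phi>[unfolded graph_grp_def]] unfolding graph_grp_def by blast
  have "\<forall>t\<in>T. \<exists>f. f \<in> graph_hom X Y \<and> (\<forall>z\<in>graph_pts X. h t z = map_option f z)"
    using graph_hom_struct_hom[OF X h] by blast
  then obtain F where F: "\<And>t. t \<in> T \<Longrightarrow> F t \<in> graph_hom X Y"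
    "\<And>t z. t \<in> T \<Longrightarrow> z \<in> graph_pts X \<Longrightarrow> h t z = map_option (F t) z" by metis
  \<comment> \<open>Several \<open>t\<close> may induce the same graph map. Their coefficients are
    added up so that the sum runs over distinct maps, as an argument by linear independence
    requires.\<close>
  define N where "N f = (\<Sum>t\<in>{t \<in> T. F t = f}. n t)" for f
  have sum_scale: "(\<Sum>t\<in>S. scale (n t) w) = scale (\<Sum>t\<in>S. n t) w" for S and w :: "(nat \<Rightarrow> 'a option) \<times> ix \<Rightarrow> rat"
    by (simp add: fun_eq_iff sum_fun_apply scale_def sum_distrib_right)
  show ?thesis
  proof (intro exI[of _ "F ` T"] exI[of _ N] conjI ballI)
    show "N f \<in> \<int>" for f unfolding N_def by (intro Ints_sum) (simp add: T)
    fix v assume v: "v \<in> graph_grp X"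
    have "\<phi> v = (\<Sum>t\<in>T. scale (n t) (grp_map (map_option (F t)) v))"
      unfolding \<phi>_eq[OF v] using v F(2) unfolding graph_grp_def
      by (intro sum.cong refl arg_cong[of _ _ "scale _"] grp_map_cong) auto
    also have "\<dots> = (\<Sum>f\<in>F ` T. \<Sum>t\<in>{t \<in> T. F t = f}. scale (n t) (grp_map (map_option (F t)) v))"
      by (rule sum.image_gen[OF T(1)])
    also have "\<dots> = (\<Sum>f\<in>F ` T. scale (N f) (grp_map (map_option f) v))"
      unfolding N_def sum_scale[symmetric] by (intro sum.cong) auto
    finally show "\<phi> v = (\<Sum>f\<in>F ` T. scale (N f) (grp_map (map_option f) v))" .
  qed (use T F in auto)
qed

text \<open>Expand \<open>\<phi>\<close> over graph maps from \<open>B\<close> to \<open>X\<close>.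
  They remain distinct after composition with \<open>f\<close>, so linear independence over
  \<open>A\<close> makes all coefficients vanish.\<close>

lemma graph_grp_ext_unique:
  assumes B: "snd B \<subseteq> fst B \<times> fst B" and f: "f \<in> graph_hom A B"
    and inj: "inj_on (\<lambda>g. compose (fst A) g f) (graph_hom B X)"
    and \<phi>: "additive_on (graph_grp B) \<phi>" "\<phi> ` graph_grp B \<subseteq> graph_grp X"
    and zero: "\<And>v. v \<in> graph_grp A \<Longrightarrow> \<phi> (grp_map (map_option f) v) = 0"
    and v: "v \<in> graph_grp B"
  shows "\<phi> v = 0"
proof -
  obtain H N where "finite H \<and> H \<subseteq> graph_hom B X \<and> (\<forall>h\<in>H. N h \<in> \<int>) \<and>
    (\<forall>v\<in>graph_grp B. \<phi> v = (\<Sum>h\<in>H. scale (N h) (grp_map (map_option h) v)))"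
    using graph_grp_hom_expansion[OF B \<phi>] by blast
  then have H: "finite H" "H \<subseteq> graph_hom B X" "\<And>h. h \<in> H \<Longrightarrow> N h \<in> \<int>"
    and \<phi>_eq: "\<And>v. v \<in> graph_grp B \<Longrightarrow> \<phi> v = (\<Sum>h\<in>H. scale (N h) (grp_map (map_option h) v))"
    by blast+
  have "N h = 0" if "h \<in> H" for h
  proof (rule grp_map_independent[where k = "\<lambda>h. map_option (compose (fst A) h f)"
        and Z = "graph_pts A" and r = "graph_rels A" and H = H and N = N])
    show "inj_on (\<lambda>h. restrict (map_option (compose (fst A) h f)) (graph_pts A)) H"
    proof (rule inj_onI)
      fix h h' assume "h \<in> H" "h' \<in> H"
        and eq: "restrict (map_option (compose (fst A) h f)) (graph_pts A) =
          restrict (map_option (compose (fst A) h' f)) (graph_pts A)"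
      have "compose (fst A) h f x = compose (fst A) h' f x" for x
        using fun_cong[OF eq, of "Some x"]
        by (cases "x \<in> fst A") (auto simp: graph_pts_def compose_def)
      then have "compose (fst A) h f = compose (fst A) h' f" by (rule ext)
      then show "h = h'" using inj_onD[OF inj] \<open>h \<in> H\<close> \<open>h' \<in> H\<close> H(2) by blast
    qed
    fix v assume "v \<in> grp (graph_pts A) (graph_rels A)"
    then have v: "v \<in> graph_grp A" by (simp add: graph_grp_def)
    show "(\<Sum>h\<in>H. scale (N h) (grp_map (map_option (compose (fst A) h f)) v)) = 0"
      using zero[OF v] unfolding \<phi>_eq[OF graph_grp_map[OF f v]] graph_grp_map_compose[OF v] .
  qed (use H that in \<open>auto simp: graph_pts_def\<close>)
  then show ?thesis unfolding \<phi>_eq[OF v] by simp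
qed

text \<open>Expand \<open>\<phi>\<close> over graph maps from \<open>A\<close> to \<open>X\<close>
  and extend each of them along \<open>f\<close> with the same coefficient. Integrality of the
  coefficients keeps the values in the group of \<open>X\<close>.\<close>

lemma graph_grp_ext_exists:
  assumes A: "snd A \<subseteq> fst A \<times> fst A" and f: "f \<in> graph_hom A B"
    and surj: "graph_hom A X \<subseteq> (\<lambda>g. compose (fst A) g f) ` graph_hom B X"
    and \<phi>: "additive_on (graph_grp A) \<phi>" "\<phi> ` graph_grp A \<subseteq> graph_grp X"
  obtains \<psi> where "additive_on (graph_grp B) \<psi>" "\<psi> ` graph_grp B \<subseteq> graph_grp X"
    "\<And>v. v \<in> graph_grp A \<Longrightarrow> \<psi> (grp_map (map_option f) v) = \<phi> v"
proof -
  obtain H N where "finite H \<and> H \<subseteq> graph_hom A X \<and> (\<forall>h\<in>H. N h \<in> \<int>) \<and>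
    (\<forall>v\<in>graph_grp A. \<phi> v = (\<Sum>h\<in>H. scale (N h) (grp_map (map_option h) v)))"
    using graph_grp_hom_expansion[OF A \<phi>] by blast
  then have H: "finite H" "H \<subseteq> graph_hom A X" "\<And>h. h \<in> H \<Longrightarrow> N h \<in> \<int>"
    and \<phi>_eq: "\<And>v. v \<in> graph_grp A \<Longrightarrow> \<phi> v = (\<Sum>h\<in>H. scale (N h) (grp_map (map_option h) v))"
    by blast+
  have "\<forall>h\<in>H. \<exists>g. g \<in> graph_hom B X \<and> compose (fst A) g f = h"
    using H(2) surj by blast
  then obtain E where E: "\<And>h. h \<in> H \<Longrightarrow> E h \<in> graph_hom B X" "\<And>h. h \<in> H \<Longrightarrow> compose (fst A) (E h) f = h"
    by metis
  let ?\<psi> = "\<lambda>v. \<Sum>h\<in>H. scale (N h) (grp_map (map_option (E h)) v)"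
  show ?thesis
  proof (rule that[of ?\<psi>])
    show "additive_on (graph_grp B) ?\<psi>" unfolding graph_grp_def by (rule additive_on_sum_grp_map)
    show "?\<psi> ` graph_grp B \<subseteq> graph_grp X"
      using graph_grp_map[OF E(1)] H(3) unfolding graph_grp_def grp_def
      by (auto intro!: divspan_sum_scale)
    fix v assume v: "v \<in> graph_grp A"
    show "?\<psi> (grp_map (map_option f) v) = \<phi> v"
      unfolding graph_grp_map_compose[OF v] \<phi>_eq[OF v] by (intro sum.cong) (simp_all add: E)
  qed
qed

section \<open>Transport of groups and homomorphisms to carriers inside the universe\<close>

definition coded_group :: "('b \<Rightarrow> 'v) \<Rightarrow> 'b::ab_group_add set \<Rightarrow> 'v monoid" where
  "coded_group c S = \<lparr>carrier = c ` S, monoid.mult = \<lambda>x y. c (inv_into S c x + inv_into S c y), one = c 0\<rparr>"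

lemma coded_group_simps [simp]:
  "carrier (coded_group c S) = c ` S"
  "one (coded_group c S) = c 0"
  by (simp_all add: coded_group_def)

lemma coded_group_mult [simp]:
  "inj_on c S \<Longrightarrow> v \<in> S \<Longrightarrow> w \<in> S \<Longrightarrow> c v \<otimes>\<^bsub>coded_group c S\<^esub> c w = c (v + w)"
  by (simp add: coded_group_def)

lemma comm_group_coded_group:
  assumes c: "inj_on c S" and S: "0 \<in> S" "\<And>v w. v \<in> S \<Longrightarrow> w \<in> S \<Longrightarrow> v + w \<in> S"
    "\<And>v w. v \<in> S \<Longrightarrow> w \<in> S \<Longrightarrow> v - w \<in> S"
  shows "comm_group (coded_group c S)"
proof (rule comm_groupI)
  show "\<exists>y\<in>carrier (coded_group c S). y \<otimes>\<^bsub>coded_group c S\<^esub> x = \<one>\<^bsub>coded_group c S\<^esub>"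
    if x: "x \<in> carrier (coded_group c S)" for x
  proof -
    obtain v where v: "v \<in> S" "x = c v" using x by auto
    have "- v \<in> S" using S(3)[OF S(1) v(1)] by simp
    then show ?thesis using v c by (intro bexI[of _ "c (- v)"]) auto
  qed
qed (use c S in \<open>auto simp: ac_simps\<close>)

lemma coded_hom:
  assumes c: "inj_on c S" and d: "inj_on d T" and S: "\<And>v w. v \<in> S \<Longrightarrow> w \<in> S \<Longrightarrow> v + w \<in> S"
    and \<phi>: "\<phi> ` S \<subseteq> T" "\<And>v w. v \<in> S \<Longrightarrow> w \<in> S \<Longrightarrow> \<phi> (v + w) = \<phi> v + \<phi> w"
  shows "(\<lambda>x\<in>c ` S. d (\<phi> (inv_into S c x))) \<in> hom (coded_group c S) (coded_group d T) \<inter> extensional (c ` S)"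
proof -
  have T: "\<phi> v \<in> T" if "v \<in> S" for v using \<phi>(1) that by blast
  have "(\<lambda>x\<in>c ` S. d (\<phi> (inv_into S c x))) \<in> hom (coded_group c S) (coded_group d T)"
  proof (rule homI)
    fix x y assume "x \<in> carrier (coded_group c S)" "y \<in> carrier (coded_group c S)"
    then obtain v w where vw: "v \<in> S" "w \<in> S" "x = c v" "y = c w" by auto
    then show "(\<lambda>x\<in>c ` S. d (\<phi> (inv_into S c x))) (x \<otimes>\<^bsub>coded_group c S\<^esub> y) =
        (\<lambda>x\<in>c ` S. d (\<phi> (inv_into S c x))) x \<otimes>\<^bsub>coded_group d T\<^esub> (\<lambda>x\<in>c ` S. d (\<phi> (inv_into S c x))) y"
      using S[OF vw(1,2)] by (simp add: c d T \<phi>(2))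
  qed (auto simp: c T)
  then show ?thesis by simp
qed

lemma decoded_hom:
  assumes c: "inj_on c S" and d: "inj_on d T" and T: "\<And>v w. v \<in> T \<Longrightarrow> w \<in> T \<Longrightarrow> v + w \<in> T"
    and g: "g \<in> hom (coded_group c S) (coded_group d T)"
  shows "\<exists>\<phi>. \<phi> ` S \<subseteq> T \<and> (\<forall>v\<in>S. \<forall>w\<in>S. \<phi> (v + w) = \<phi> v + \<phi> w) \<and>
    (\<forall>v\<in>S. g (c v) = d (\<phi> v))"
proof (intro exI[of _ "\<lambda>v. inv_into T d (g (c v))"] conjI ballI)
  have mem: "g (c v) \<in> d ` T" if "v \<in> S" for v
    using hom_in_carrier[OF g, of "c v"] that by simp
  show "(\<lambda>v. inv_into T d (g (c v))) ` S \<subseteq> T" using mem by (auto intro: inv_into_into)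
  show eq: "g (c v) = d (inv_into T d (g (c v)))" if "v \<in> S" for v
    using mem[OF that] by (simp add: f_inv_into_f)
  fix v w assume v: "v \<in> S" and w: "w \<in> S"
  have "g (c (v + w)) = g (c v \<otimes>\<^bsub>coded_group c S\<^esub> c w)" using c v w by simp
  also have "\<dots> = g (c v) \<otimes>\<^bsub>coded_group d T\<^esub> g (c w)" using g v w by (intro hom_mult) simp_all
  also have "\<dots> = d (inv_into T d (g (c v)) + inv_into T d (g (c w)))"
    by (simp add: coded_group_def)
  finally show "inv_into T d (g (c (v + w))) = inv_into T d (g (c v)) + inv_into T d (g (c w))"
    using d mem[OF v] mem[OF w] by (simp add: inv_into_into T)
qed

section \<open>Objects, arrows and points under the functor\<close>

definition graph_code :: "('v \<Rightarrow> 'v set) \<Rightarrow> 'v graph \<Rightarrow> ((nat \<Rightarrow> 'v option) \<times> ix \<Rightarrow> rat) \<Rightarrow> 'v" where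
  "graph_code elts X = set_code elts (graph_grp X)"

definition ab_obj :: "('v \<Rightarrow> 'v set) \<Rightarrow> 'v graph \<Rightarrow> 'v monoid" where
  "ab_obj elts X = coded_group (graph_code elts X) (graph_grp X)"

definition ab_map :: "('v \<Rightarrow> 'v set) \<Rightarrow> 'v graph \<Rightarrow> 'v graph \<Rightarrow> ('v \<Rightarrow> 'v) \<Rightarrow> 'v \<Rightarrow> 'v" where
  "ab_map elts X Y f = (\<lambda>x\<in>graph_code elts X ` graph_grp X.
    graph_code elts Y (grp_map (map_option f) (inv_into (graph_grp X) (graph_code elts X) x)))"

text \<open>Constant sequences embed the points of a graph into its group, compatibly with graph
  maps (\<open>ab_map_pt\<close>). The size of a hull is measured through this embedding.\<close>

definition ab_pt :: "('v \<Rightarrow> 'v set) \<Rightarrow> 'v graph \<Rightarrow> 'v \<Rightarrow> 'v" where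
  "ab_pt elts X x = graph_code elts X (unit_vec (\<lambda>_. Some x, Id))"

lemma Obj_graph_cat: "X \<in> Obj (graph_cat elts) \<longleftrightarrow> small elts (fst X) \<and> snd X \<subseteq> fst X \<times> fst X"
  by (cases X) (simp add: graph_cat_def)

lemma Hom_graph_cat [simp]: "Hom (graph_cat elts) = graph_hom"
  and Comp_graph_cat [simp]: "Comp (graph_cat elts) A g f = compose (fst A) g f"
  by (simp_all add: graph_cat_def)

lemma unit_vec_pt: "x \<in> fst X \<Longrightarrow> unit_vec (\<lambda>_. Some x, Id) \<in> graph_grp X"
  unfolding graph_grp_def by (rule unit_vec_grp) (auto simp: seqs_def graph_pts_def)

lemma graph_grp_add: "v \<in> graph_grp X \<Longrightarrow> w \<in> graph_grp X \<Longrightarrow> v + w \<in> graph_grp X"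
  unfolding graph_grp_def by (rule grp_add)

context zfc_universe
begin

lemma inj_graph_code:
  assumes "X \<in> Obj (graph_cat elts)"
  shows "inj_on (graph_code elts X) (graph_grp X)" "small elts (graph_code elts X ` graph_grp X)"
proof -
  have "sized elts (fst X <+> (UNIV :: unit set))"
    using assms by (intro sized_Plus sized_countable) (simp add: Obj_graph_cat sized_iff_small)
  then have "sized elts (graph_pts X)"
    by (rule sized_inj[of "case_option (Inr ()) Inl", rotated 2])
      (auto simp: inj_on_def graph_pts_def)
  then have "sized elts (graph_grp X)" unfolding graph_grp_def by (rule sized_grp)
  then show "inj_on (graph_code elts X) (graph_grp X)" "small elts (graph_code elts X ` graph_grp X)"
    unfolding graph_code_def by (simp_all add: inj_small_code)
qed

lemma ab_obj_Obj: "X \<in> Obj (graph_cat elts) \<Longrightarrow> ab_obj elts X \<in> Obj (ab_cat elts)"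
  using inj_graph_code[of X] grp_0 grp_add grp_diff
  by (auto simp: ab_cat_def ab_obj_def graph_grp_def intro!: comm_group_coded_group)

lemma ab_map_code:
  assumes "X \<in> Obj (graph_cat elts)" "v \<in> graph_grp X"
  shows "ab_map elts X Y f (graph_code elts X v) = graph_code elts Y (grp_map (map_option f) v)"
  using assms by (simp add: ab_map_def inj_graph_code)

lemma ab_map_Hom:
  assumes "X \<in> Obj (graph_cat elts)" "Y \<in> Obj (graph_cat elts)" "f \<in> graph_hom X Y"
  shows "ab_map elts X Y f \<in> Hom (ab_cat elts) (ab_obj elts X) (ab_obj elts Y)"
proof -
  have "ab_map elts X Y f \<in> hom (ab_obj elts X) (ab_obj elts Y) \<inter> extensional (graph_code elts X ` graph_grp X)"
    unfolding ab_map_def ab_obj_def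
    using inj_graph_code(1)[OF assms(1)] inj_graph_code(1)[OF assms(2)] graph_grp_add
  proof (rule coded_hom)
    show "grp_map (map_option f) ` graph_grp X \<subseteq> graph_grp Y"
      using graph_grp_map[OF assms(3)] by blast
    show "grp_map (map_option f) (v + w) = grp_map (map_option f) v + grp_map (map_option f) w"
      if "v \<in> graph_grp X" "w \<in> graph_grp X" for v w
      using that unfolding graph_grp_def by (rule grp_map_add)
  qed
  then show ?thesis by (simp add: ab_cat_def ab_obj_def)
qed

lemma ab_map_compose:
  assumes "A \<in> Obj (graph_cat elts)" "B \<in> Obj (graph_cat elts)" "f \<in> graph_hom A B"
  shows "compose (carrier (ab_obj elts A)) (ab_map elts B X g) (ab_map elts A B f) =
    ab_map elts A X (compose (fst A) g f)"
proof
  fix x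
  show "compose (carrier (ab_obj elts A)) (ab_map elts B X g) (ab_map elts A B f) x =
    ab_map elts A X (compose (fst A) g f) x"
  proof (cases "x \<in> graph_code elts A ` graph_grp A")
    case True
    then obtain v where v: "v \<in> graph_grp A" "x = graph_code elts A v" by blast
    then show ?thesis
      using assms by (simp add: ab_obj_def compose_eq ab_map_code graph_grp_map graph_grp_map_compose)
  next
    case False
    then show ?thesis by (simp add: ab_obj_def ab_map_def compose_def)
  qed
qed

lemma ab_pt_mem: "x \<in> fst X \<Longrightarrow> ab_pt elts X x \<in> carrier (ab_obj elts X)"
  by (simp add: ab_pt_def ab_obj_def unit_vec_pt)

lemma inj_on_ab_pt: "X \<in> Obj (graph_cat elts) \<Longrightarrow> inj_on (ab_pt elts X) (fst X)"
proof (rule inj_onI)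
  fix x y assume X: "X \<in> Obj (graph_cat elts)" and xy: "x \<in> fst X" "y \<in> fst X"
    "ab_pt elts X x = ab_pt elts X y"
  have eq: "unit_vec (\<lambda>_::nat. Some x, Id) = unit_vec (\<lambda>_. Some y, Id)"
    using xy(3) unfolding ab_pt_def
    by (rule inj_onD[OF inj_graph_code(1)[OF X] _ unit_vec_pt[OF xy(1)] unit_vec_pt[OF xy(2)]])
  show "x = y"
    using fun_cong[OF eq, of "(\<lambda>_. Some x, Id)"] by (auto simp: unit_vec_apply fun_eq_iff)
qed

lemma ab_map_pt:
  assumes "A \<in> Obj (graph_cat elts)" "x \<in> fst A"
  shows "ab_map elts A B f (ab_pt elts A x) = ab_pt elts B (f x)"
  using assms by (simp add: ab_pt_def ab_map_code unit_vec_pt comp_def)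

text \<open>Precomposition with \<open>f\<close> matches the bases of the two free hom-groups.
  Injectivity follows by applying \<open>graph_grp_ext_unique\<close> to the difference of two
  additive maps, surjectivity from \<open>graph_grp_ext_exists\<close>.\<close>

lemma orthogonal_ab_obj:
  assumes A: "A \<in> Obj (graph_cat elts)" and B: "B \<in> Obj (graph_cat elts)"
    and X: "X \<in> Obj (graph_cat elts)" and f: "f \<in> graph_hom A B"
    and orth: "orthogonal (graph_cat elts) (A, B, f) X"
  shows "orthogonal (ab_cat elts) (ab_obj elts A, ab_obj elts B, ab_map elts A B f) (ab_obj elts X)"
proof -
  let ?a = "graph_code elts A" and ?b = "graph_code elts B" and ?x = "graph_code elts X"
  let ?A = "graph_grp A" and ?B = "graph_grp B" and ?X = "graph_grp X"
  note a = inj_graph_code(1)[OF A] and b = inj_graph_code(1)[OF B] and x = inj_graph_code(1)[OF X]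
  let ?HA = "hom (coded_group ?a ?A) (coded_group ?x ?X) \<inter> extensional (?a ` ?A)"
  let ?HB = "hom (coded_group ?b ?B) (coded_group ?x ?X) \<inter> extensional (?b ` ?B)"
  let ?F = "\<lambda>g. compose (?a ` ?A) g (ab_map elts A B f)"
  have bij: "bij_betw (\<lambda>g. compose (fst A) g f) (graph_hom B X) (graph_hom A X)"
    using orth by simp
  have F: "?F g (?a v) = g (?b (grp_map (map_option f) v))" if "v \<in> ?A" for g v
    using that by (simp add: compose_eq ab_map_code[OF A])
  have "bij_betw ?F ?HB ?HA"
  proof (rule bij_betw_imageI)
    show "inj_on ?F ?HB"
    proof (rule inj_onI)
      fix g g' assume g: "g \<in> ?HB" and g': "g' \<in> ?HB" and eq: "?F g = ?F g'"
      obtain \<phi> where \<phi>: "\<phi> ` ?B \<subseteq> ?X" "\<And>v w. v \<in> ?B \<Longrightarrow> w \<in> ?B \<Longrightarrow> \<phi> (v + w) = \<phi> v + \<phi> w"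
          "\<And>v. v \<in> ?B \<Longrightarrow> g (?b v) = ?x (\<phi> v)"
        using decoded_hom[OF b x graph_grp_add, where g = g] g by blast
      obtain \<phi>' where \<phi>': "\<phi>' ` ?B \<subseteq> ?X" "\<And>v w. v \<in> ?B \<Longrightarrow> w \<in> ?B \<Longrightarrow> \<phi>' (v + w) = \<phi>' v + \<phi>' w"
          "\<And>v. v \<in> ?B \<Longrightarrow> g' (?b v) = ?x (\<phi>' v)"
        using decoded_hom[OF b x graph_grp_add, where g = g'] g' by blast
      have agree: "\<phi> v = \<phi>' v" if v: "v \<in> ?B" for v
      proof -
        have "(\<lambda>v. \<phi> v - \<phi>' v) v = 0"
        proof (rule graph_grp_ext_unique[OF _ f bij_betw_imp_inj_on[OF bij] _ _ _ v])
          show "snd B \<subseteq> fst B \<times> fst B" using B by (simp add: Obj_graph_cat)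
          show "additive_on ?B (\<lambda>v. \<phi> v - \<phi>' v)" by (simp add: additive_on_def \<phi>(2) \<phi>'(2))
          show "(\<lambda>v. \<phi> v - \<phi>' v) ` ?B \<subseteq> ?X"
            using \<phi>(1) \<phi>'(1) unfolding graph_grp_def by (auto intro: grp_diff)
          fix u assume u: "u \<in> ?A"
          then have fu: "grp_map (map_option f) u \<in> ?B" by (rule graph_grp_map[OF f])
          have "?x (\<phi> (grp_map (map_option f) u)) = ?x (\<phi>' (grp_map (map_option f) u))"
            using fun_cong[OF eq, of "?a u"] unfolding F[OF u] \<phi>(3)[OF fu] \<phi>'(3)[OF fu] .
          then have "\<phi> (grp_map (map_option f) u) = \<phi>' (grp_map (map_option f) u)"
            using inj_onD[OF x] \<phi>(1) \<phi>'(1) fu by blast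
          then show "\<phi> (grp_map (map_option f) u) - \<phi>' (grp_map (map_option f) u) = 0" by simp
        qed
        then show ?thesis by simp
      qed
      show "g = g'"
      proof (rule extensionalityI)
        show "g \<in> extensional (?b ` ?B)" "g' \<in> extensional (?b ` ?B)" using g g' by auto
        show "g y = g' y" if "y \<in> ?b ` ?B" for y using that agree \<phi>(3) \<phi>'(3) by auto
      qed
    qed
    show "?F ` ?HB = ?HA"
    proof (intro equalityI subsetI)
      fix y assume "y \<in> ?F ` ?HB"
      then obtain g where g: "g \<in> ?HB" "y = ?F g" by blast
      have "ab_map elts A B f \<in> hom (coded_group ?a ?A) (coded_group ?b ?B)"
        using ab_map_Hom[OF A B f] by (simp add: ab_cat_def ab_obj_def)
      moreover have "g \<in> hom (coded_group ?b ?B) (coded_group ?x ?X)" using g(1) by blast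
      moreover have "comm_group (coded_group ?a ?A)"
        using ab_obj_Obj[OF A] by (simp add: ab_cat_def ab_obj_def)
      ultimately show "y \<in> ?HA"
        using group.hom_compose[of "coded_group ?a ?A" "ab_map elts A B f" "coded_group ?b ?B" g]
        unfolding g(2) by (simp add: comm_group_def)
    next
      fix g assume g: "g \<in> ?HA"
      obtain \<phi> where \<phi>: "\<phi> ` ?A \<subseteq> ?X" "\<And>v w. v \<in> ?A \<Longrightarrow> w \<in> ?A \<Longrightarrow> \<phi> (v + w) = \<phi> v + \<phi> w"
          "\<And>v. v \<in> ?A \<Longrightarrow> g (?a v) = ?x (\<phi> v)"
        using decoded_hom[OF a x graph_grp_add, where g = g] g by blast
      have "additive_on ?A \<phi>" by (simp add: additive_on_def \<phi>(2))
      moreover have "snd A \<subseteq> fst A \<times> fst A" using A by (simp add: Obj_graph_cat)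
      moreover have "graph_hom A X \<subseteq> (\<lambda>g. compose (fst A) g f) ` graph_hom B X"
        using bij_betw_imp_surj_on[OF bij] by blast
      ultimately obtain \<psi> where \<psi>: "additive_on ?B \<psi>" "\<psi> ` ?B \<subseteq> ?X"
          "\<And>v. v \<in> ?A \<Longrightarrow> \<psi> (grp_map (map_option f) v) = \<phi> v"
        using graph_grp_ext_exists[OF _ f _ _ \<phi>(1)] by blast
      let ?g = "\<lambda>y\<in>?b ` ?B. ?x (\<psi> (inv_into ?B ?b y))"
      have "?g \<in> ?HB"
        by (rule coded_hom[OF b x graph_grp_add \<psi>(2)]) (use \<psi>(1) in \<open>auto simp: additive_on_def\<close>)
      moreover have "g = ?F ?g"
      proof (rule extensionalityI)
        show "g \<in> extensional (?a ` ?A)" using g by blast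
        show "?F ?g \<in> extensional (?a ` ?A)" by (rule compose_extensional)
        fix y assume "y \<in> ?a ` ?A"
        then obtain v where v: "v \<in> ?A" "y = ?a v" by blast
        have "?F ?g y = ?g (?b (grp_map (map_option f) v))" unfolding v(2) by (rule F[OF v(1)])
        also have "\<dots> = ?x (\<phi> v)" using graph_grp_map[OF f v(1)] b v(1) by (simp add: \<psi>(3))
        finally show "g y = ?F ?g y" using \<phi>(3)[OF v(1)] v(2) by simp
      qed
      ultimately show "g \<in> ?F ` ?HB" by blast
    qed
  qed
  then show ?thesis by (simp add: ab_cat_def ab_obj_def)
qed

end

section \<open>Orthogonality of graphs\<close>

text \<open>Unlike arrows of the category of graphs, these maps are arbitrary outside the source.\<close>

definition ghom :: "'v graph \<Rightarrow> 'v graph \<Rightarrow> ('v \<Rightarrow> 'v) \<Rightarrow> bool" where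
  "ghom X Y f \<longleftrightarrow> (\<forall>x\<in>fst X. f x \<in> fst Y) \<and> (\<forall>x y. (x, y) \<in> snd X \<longrightarrow> (f x, f y) \<in> snd Y)"

text \<open>Maps are compared on their sources only, so identities and composites can be used
  without restricting them.\<close>

definition orth :: "'v graph \<Rightarrow> 'v graph \<Rightarrow> ('v \<Rightarrow> 'v) \<Rightarrow> 'v graph \<Rightarrow> bool" where
  "orth A B f X \<longleftrightarrow>
    (\<forall>g g'. ghom B X g \<longrightarrow> ghom B X g' \<longrightarrow> (\<forall>a\<in>fst A. g (f a) = g' (f a)) \<longrightarrow> (\<forall>b\<in>fst B. g b = g' b)) \<and>
    (\<forall>h. ghom A X h \<longrightarrow> (\<exists>g. ghom B X g \<and> (\<forall>a\<in>fst A. g (f a) = h a)))"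

lemma orthI:
  assumes "\<And>g g' b. ghom B X g \<Longrightarrow> ghom B X g' \<Longrightarrow> (\<And>a. a \<in> fst A \<Longrightarrow> g (f a) = g' (f a)) \<Longrightarrow>
      b \<in> fst B \<Longrightarrow> g b = g' b"
    and "\<And>h. ghom A X h \<Longrightarrow> \<exists>g. ghom B X g \<and> (\<forall>a\<in>fst A. g (f a) = h a)"
  shows "orth A B f X"
  unfolding orth_def
proof (intro conjI allI impI ballI)
  fix g g' b
  assume "ghom B X g" "ghom B X g'" "\<forall>a\<in>fst A. g (f a) = g' (f a)" "b \<in> fst B"
  then show "g b = g' b" using assms(1)[of g g' b] by blast
qed (rule assms(2))

lemma orth_unique:
  "orth A B f X \<Longrightarrow> ghom B X g \<Longrightarrow> ghom B X g' \<Longrightarrow> (\<And>a. a \<in> fst A \<Longrightarrow> g (f a) = g' (f a)) \<Longrightarrow>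
    b \<in> fst B \<Longrightarrow> g b = g' b"
  unfolding orth_def by blast

lemma orth_exists:
  "orth A B f X \<Longrightarrow> ghom A X h \<Longrightarrow> \<exists>g. ghom B X g \<and> (\<forall>a\<in>fst A. g (f a) = h a)"
  unfolding orth_def by blast

lemma ghomI:
  "(\<And>x. x \<in> fst X \<Longrightarrow> f x \<in> fst Y) \<Longrightarrow> (\<And>x y. (x, y) \<in> snd X \<Longrightarrow> (f x, f y) \<in> snd Y) \<Longrightarrow> ghom X Y f"
  unfolding ghom_def by blast

lemma ghom_pts: "ghom X Y f \<Longrightarrow> x \<in> fst X \<Longrightarrow> f x \<in> fst Y"
  and ghom_edges: "ghom X Y f \<Longrightarrow> (x, y) \<in> snd X \<Longrightarrow> (f x, f y) \<in> snd Y"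
  unfolding ghom_def by blast+

lemma ghom_comp: "ghom X Y f \<Longrightarrow> ghom Y Z g \<Longrightarrow> ghom X Z (\<lambda>x. g (f x))"
  unfolding ghom_def by blast

lemma ghom_cong:
  assumes "X \<in> Obj (graph_cat elts)" "\<And>x. x \<in> fst X \<Longrightarrow> f x = g x"
  shows "ghom X Y f \<longleftrightarrow> ghom X Y g"
proof -
  have "x \<in> fst X \<and> y \<in> fst X" if "(x, y) \<in> snd X" for x y
    using assms(1) that by (auto simp: Obj_graph_cat)
  then show ?thesis unfolding ghom_def using assms(2) by (metis (no_types, lifting))
qed

lemma graph_hom_ghom: "f \<in> graph_hom X Y \<longleftrightarrow> ghom X Y f \<and> f \<in> extensional (fst X)"
  using graph_homD[of f X Y] graph_homI[of f X Y] unfolding ghom_def by blast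

lemma restrict_graph_hom:
  assumes "X \<in> Obj (graph_cat elts)" "ghom X Y f"
  shows "restrict f (fst X) \<in> graph_hom X Y"
  using ghom_cong[OF assms(1), of "restrict f (fst X)" f Y] assms(2) by (simp add: graph_hom_ghom)

lemma orthogonal_iff_orth:
  assumes A: "A \<in> Obj (graph_cat elts)" and B: "B \<in> Obj (graph_cat elts)" and f: "ghom A B f"
  shows "orthogonal (graph_cat elts) (A, B, f) X \<longleftrightarrow> orth A B f X"
proof
  assume "orthogonal (graph_cat elts) (A, B, f) X"
  then have bij: "bij_betw (\<lambda>g. compose (fst A) g f) (graph_hom B X) (graph_hom A X)" by simp
  show "orth A B f X"
  proof (rule orthI)
    fix g g' b
    assume g: "ghom B X g" "ghom B X g'" and eq: "\<And>a. a \<in> fst A \<Longrightarrow> g (f a) = g' (f a)" and b: "b \<in> fst B"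
    have "compose (fst A) (restrict g (fst B)) f = compose (fst A) (restrict g' (fst B)) f"
      by (auto simp: compose_def eq ghom_pts[OF f])
    then have "restrict g (fst B) = restrict g' (fst B)"
      by (rule inj_onD[OF bij_betw_imp_inj_on[OF bij]]) (simp_all add: restrict_graph_hom[OF B] g)
    then show "g b = g' b" using b by (metis restrict_apply')
  next
    fix h assume "ghom A X h"
    then have "restrict h (fst A) \<in> graph_hom A X" by (rule restrict_graph_hom[OF A])
    then have "restrict h (fst A) \<in> (\<lambda>g. compose (fst A) g f) ` graph_hom B X"
      unfolding bij_betw_imp_surj_on[OF bij] .
    then obtain g where g: "g \<in> graph_hom B X" "restrict h (fst A) = compose (fst A) g f" by blast
    have "g (f a) = h a" if "a \<in> fst A" for a
      using fun_cong[OF g(2), of a] that by (simp add: compose_eq)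
    then show "\<exists>g. ghom B X g \<and> (\<forall>a\<in>fst A. g (f a) = h a)" using g(1) by (auto simp: graph_hom_ghom)
  qed
next
  assume orth: "orth A B f X"
  have "bij_betw (\<lambda>g. compose (fst A) g f) (graph_hom B X) (graph_hom A X)"
  proof (rule bij_betw_imageI)
    show "inj_on (\<lambda>g. compose (fst A) g f) (graph_hom B X)"
    proof (rule inj_onI)
      fix g g' assume g: "g \<in> graph_hom B X" "g' \<in> graph_hom B X"
        and eq: "compose (fst A) g f = compose (fst A) g' f"
      have "g (f a) = g' (f a)" if "a \<in> fst A" for a
        using fun_cong[OF eq, of a] that by (simp add: compose_eq)
      then have "g b = g' b" if "b \<in> fst B" for b
        using orth_unique[OF orth _ _ _ that] g by (simp add: graph_hom_ghom)
      then show "g = g'" using g by (auto simp: graph_hom_ghom intro: extensionalityI)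
    qed
    show "(\<lambda>g. compose (fst A) g f) ` graph_hom B X = graph_hom A X"
    proof (intro equalityI subsetI)
      fix h assume "h \<in> (\<lambda>g. compose (fst A) g f) ` graph_hom B X"
      then obtain g where g: "g \<in> graph_hom B X" "h = compose (fst A) g f" by blast
      have "ghom A X (\<lambda>x. g (f x))" using f g(1) by (simp add: graph_hom_ghom ghom_comp)
      then show "h \<in> graph_hom A X" unfolding g(2) compose_def by (rule restrict_graph_hom[OF A])
    next
      fix h assume h: "h \<in> graph_hom A X"
      then obtain g where g: "ghom B X g" "\<forall>a\<in>fst A. g (f a) = h a"
        using orth_exists[OF orth] by (auto simp: graph_hom_ghom)
      have "h = compose (fst A) (restrict g (fst B)) f"
        using h g(2) by (auto simp: graph_hom_ghom compose_def ghom_pts[OF f] extensional_def)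
      then show "h \<in> (\<lambda>g. compose (fst A) g f) ` graph_hom B X"
        using restrict_graph_hom[OF B g(1)] by blast
    qed
  qed
  then show "orthogonal (graph_cat elts) (A, B, f) X" by simp
qed

text \<open>Membership in \<open>perp_morphisms\<close> up to the values of the arrow outside its
  source.\<close>

definition perp :: "('v \<Rightarrow> 'v set) \<Rightarrow> 'v graph set \<Rightarrow> 'v graph \<Rightarrow> 'v graph \<Rightarrow> ('v \<Rightarrow> 'v) \<Rightarrow> bool" where
  "perp elts D A B f \<longleftrightarrow> A \<in> Obj (graph_cat elts) \<and> B \<in> Obj (graph_cat elts) \<and> ghom A B f \<and>
    (\<forall>X\<in>D. orth A B f X)"

lemma perp_morphisms_iff:
  "(A, B, f) \<in> perp_morphisms (graph_cat elts) D \<longleftrightarrow> perp elts D A B f \<and> f \<in> extensional (fst A)"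
proof -
  have *: "(A, B, f) \<in> Mor (graph_cat elts) \<longleftrightarrow> A \<in> Obj (graph_cat elts) \<and> B \<in> Obj (graph_cat elts) \<and>
      ghom A B f \<and> f \<in> extensional (fst A)"
    by (simp add: Mor_def graph_hom_ghom)
  show ?thesis
    unfolding perp_morphisms_def perp_def mem_Collect_eq * using orthogonal_iff_orth[of A elts B f]
    by blast
qed

lemma perp_restrict:
  assumes "perp elts D A B f"
  shows "perp elts D A B (restrict f (fst A))"
proof -
  have A: "A \<in> Obj (graph_cat elts)" using assms by (simp add: perp_def)
  have "orth A B (restrict f (fst A)) X \<longleftrightarrow> orth A B f X" for X
    unfolding orth_def by simp
  then show ?thesis
    using assms restrict_graph_hom[OF A, of B f] by (simp add: perp_def graph_hom_ghom)
qed

lemma perp_id: "A \<in> Obj (graph_cat elts) \<Longrightarrow> perp elts D A A (\<lambda>x. x)"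
  unfolding perp_def by (auto intro!: orthI ghomI)

lemma perp_comp:
  assumes "perp elts D A B f" "perp elts D B C g"
  shows "perp elts D A C (\<lambda>x. g (f x))"
  unfolding perp_def
proof (intro conjI ballI)
  fix X assume X: "X \<in> D"
  have orth: "orth A B f X" "orth B C g X" using assms X by (auto simp: perp_def)
  show "orth A C (\<lambda>x. g (f x)) X"
  proof (rule orthI)
    fix u u' c
    assume u: "ghom C X u" "ghom C X u'" and eq: "\<And>a. a \<in> fst A \<Longrightarrow> u (g (f a)) = u' (g (f a))"
      and c: "c \<in> fst C"
    have g: "ghom B C g" using assms by (simp add: perp_def)
    have "u (g b) = u' (g b)" if "b \<in> fst B" for b
      using orth_unique[OF orth(1) ghom_comp[OF g u(1)] ghom_comp[OF g u(2)] eq that] .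
    then show "u c = u' c" using orth_unique[OF orth(2) u _ c] by blast
  next
    fix h assume "ghom A X h"
    then obtain v where v: "ghom B X v" "\<forall>a\<in>fst A. v (f a) = h a"
      using orth_exists[OF orth(1)] by blast
    then obtain u where "ghom C X u" "\<forall>b\<in>fst B. u (g b) = v b"
      using orth_exists[OF orth(2)] by blast
    moreover have "f a \<in> fst B" if "a \<in> fst A" for a
      using assms(1) that by (auto simp: perp_def intro: ghom_pts)
    ultimately show "\<exists>u. ghom C X u \<and> (\<forall>a\<in>fst A. u (g (f a)) = h a)" using v(2) by auto
  qed
qed (use assms in \<open>auto simp: perp_def intro: ghom_comp\<close>)

section \<open>Products, and cobase change of morphisms orthogonal to a class\<close>

context zfc_universe
begin

text \<open>Joint injectivity of the projections stands in for the uniqueness clause of the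
  universal property and reduces equations in \<open>P\<close> to the factors.\<close>

lemma product:
  assumes K: "sized elts K" and X: "\<And>k. k \<in> K \<Longrightarrow> X k \<in> Obj (graph_cat elts)"
  shows "\<exists>P \<pi>. P \<in> Obj (graph_cat elts) \<and> (\<forall>k\<in>K. ghom P (X k) (\<pi> k)) \<and>
    (\<forall>x\<in>fst P. \<forall>y\<in>fst P. (\<forall>k\<in>K. \<pi> k x = \<pi> k y) \<longrightarrow> x = y) \<and>
    (\<forall>Z\<in>Obj (graph_cat elts). \<forall>h. (\<forall>k\<in>K. ghom Z (X k) (h k)) \<longrightarrow>
      (\<exists>g. ghom Z P g \<and> (\<forall>k\<in>K. \<forall>z\<in>fst Z. \<pi> k (g z) = h k z)))"
proof -
  let ?S = "PiE K (\<lambda>k. fst (X k))"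
  have "sized elts (\<Union>k\<in>K. fst (X k))"
    unfolding sized_iff_small using K X by (intro small_UN) (auto simp: Obj_graph_cat)
  with K have "sized elts (K \<rightarrow>\<^sub>E (\<Union>k\<in>K. fst (X k)))" by (rule sized_PiE)
  then have S: "sized elts ?S" by (rule sized_subset) (auto simp: PiE_iff)
  define c where "c = set_code elts ?S"
  have c: "inj_on c ?S" "small elts (c ` ?S)" unfolding c_def using inj_small_code[OF S] by simp_all
  define P where "P = (c ` ?S, {(c s, c t) |s t. s \<in> ?S \<and> t \<in> ?S \<and> (\<forall>k\<in>K. (s k, t k) \<in> snd (X k))})"
  define \<pi> where "\<pi> k y = inv_into ?S c y k" for k y
  have \<pi>: "\<pi> k (c s) = s k" if "s \<in> ?S" for s k using c(1) that by (simp add: \<pi>_def)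
  have "P \<in> Obj (graph_cat elts)" using c(2) by (auto simp: P_def Obj_graph_cat)
  moreover have "ghom P (X k) (\<pi> k)" if "k \<in> K" for k
    using that by (intro ghomI) (auto simp: P_def \<pi>)
  moreover have "x = y" if xy: "x \<in> fst P" "y \<in> fst P" and eq: "\<And>k. k \<in> K \<Longrightarrow> \<pi> k x = \<pi> k y" for x y
  proof -
    obtain s t where st: "s \<in> ?S" "t \<in> ?S" "x = c s" "y = c t" using xy by (auto simp: P_def)
    have "s = t" using st(1,2) by (rule PiE_ext) (use eq in \<open>simp add: st \<pi>\<close>)
    then show ?thesis by (simp add: st)
  qed
  moreover have "\<exists>g. ghom Z P g \<and> (\<forall>k\<in>K. \<forall>z\<in>fst Z. \<pi> k (g z) = h k z)"
    if Z: "Z \<in> Obj (graph_cat elts)" and h: "\<And>k. k \<in> K \<Longrightarrow> ghom Z (X k) (h k)" for Z h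
  proof -
    let ?g = "\<lambda>z. c (\<lambda>k\<in>K. h k z)"
    have mem: "(\<lambda>k\<in>K. h k z) \<in> ?S" if "z \<in> fst Z" for z using h that by (auto intro: ghom_pts)
    have Z': "z \<in> fst Z \<and> z' \<in> fst Z" if "(z, z') \<in> snd Z" for z z'
      using Z that by (auto simp: Obj_graph_cat)
    have "ghom Z P ?g"
    proof (rule ghomI)
      show "?g z \<in> fst P" if "z \<in> fst Z" for z using mem[OF that] by (simp add: P_def)
      fix z z' assume zz: "(z, z') \<in> snd Z"
      have "(\<lambda>k\<in>K. h k z) \<in> ?S" "(\<lambda>k\<in>K. h k z') \<in> ?S" using mem Z'[OF zz] by blast+
      moreover have "\<forall>k\<in>K. ((\<lambda>k\<in>K. h k z) k, (\<lambda>k\<in>K. h k z') k) \<in> snd (X k)"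
        using ghom_edges[OF h zz] by simp
      ultimately show "(?g z, ?g z') \<in> snd P" unfolding P_def snd_conv by blast
    qed
    moreover have "\<forall>k\<in>K. \<forall>z\<in>fst Z. \<pi> k (?g z) = h k z" using \<pi>[OF mem] by simp
    ultimately show ?thesis by blast
  qed
  ultimately show ?thesis by (intro exI[of _ P] exI[of _ \<pi>] conjI) blast+
qed

text \<open>The quotient of the disjoint union by the relation that no compatible pair of maps to a
  member of \<open>D\<close> can detect replaces the pushout of \<open>I\<close> and \<open>C'\<close> over \<open>C\<close>.\<close>

lemma perp_pushout:
  assumes f: "perp elts D C C' f" and I: "I \<in> Obj (graph_cat elts)" and c: "ghom C I c"
  shows "\<exists>B p q. perp elts D I B p \<and> ghom C' B q \<and> (\<forall>x\<in>fst C. q (f x) = p (c x))"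
proof -
  have C': "C' \<in> Obj (graph_cat elts)" and fh: "ghom C C' f" using f by (auto simp: perp_def)
  let ?S = "fst I <+> fst C'"
  have "sized elts ?S"
    using I C' by (intro sized_Plus) (simp_all add: sized_iff_small Obj_graph_cat)
  then obtain k :: "_ \<Rightarrow> 'v" where k: "inj_on k ?S" "small elts (k ` ?S)"
    unfolding sized_def by blast
  define compat where "compat X u v \<longleftrightarrow> X \<in> D \<and> ghom I X u \<and> ghom C' X v \<and> (\<forall>x\<in>fst C. v (f x) = u (c x))"
    for X u v
  define eqv where "eqv z z' \<longleftrightarrow> (\<forall>X u v. compat X u v \<longrightarrow> case_sum u v z = case_sum u v z')" for z z'
  \<comment> \<open>Equivalent elements satisfy the same predicate \<open>eqv z\<close>, so the
    choice gives them the same representative. The quotient thus stays inside the coded disjoint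
    union and is small, although \<open>eqv\<close> quantifies over a possibly proper class.\<close>
  define r where "r z = (SOME z'. z' \<in> ?S \<and> eqv z z')" for z
  have r: "r z \<in> ?S \<and> eqv z (r z)" if "z \<in> ?S" for z
    unfolding r_def by (rule someI[of _ z]) (use that in \<open>simp add: eqv_def\<close>)
  have r_eq: "r z = r z'" if "eqv z z'" for z z'
  proof -
    have "eqv z = eqv z'" using that by (auto simp: eqv_def fun_eq_iff)
    then show ?thesis by (simp add: r_def)
  qed
  define cl where "cl z = k (r z)" for z
  define B where "B = (cl ` ?S, map_prod (\<lambda>x. cl (Inl x)) (\<lambda>x. cl (Inl x)) ` snd I \<union>
    map_prod (\<lambda>x. cl (Inr x)) (\<lambda>x. cl (Inr x)) ` snd C')"
  define p where "p x = cl (Inl x)" for x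
  define q where "q x = cl (Inr x)" for x
  have "cl ` ?S \<subseteq> k ` ?S" using r by (auto simp: cl_def)
  then have "small elts (cl ` ?S)" using k(2) small_subset by blast
  moreover have "snd I \<subseteq> fst I \<times> fst I" "snd C' \<subseteq> fst C' \<times> fst C'"
    using I C' by (auto simp: Obj_graph_cat)
  ultimately have B: "B \<in> Obj (graph_cat elts)" by (fastforce simp: B_def Obj_graph_cat)
  have p: "ghom I B p" by (rule ghomI) (auto simp: B_def p_def)
  have q: "ghom C' B q" by (rule ghomI) (auto simp: B_def q_def)
  have pq: "q (f x) = p (c x)" if "x \<in> fst C" for x
  proof -
    have "eqv (Inr (f x)) (Inl (c x))" using that by (simp add: eqv_def compat_def)
    then show ?thesis unfolding p_def q_def cl_def by (simp add: r_eq)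
  qed
  have cases: "(\<exists>x\<in>fst I. y = p x) \<or> (\<exists>x\<in>fst C'. y = q x)" if "y \<in> fst B" for y
    using that by (auto simp: B_def p_def q_def)
  have "orth I B p X" if X: "X \<in> D" for X
  proof (rule orthI)
    have orth: "orth C C' f X" using f X by (simp add: perp_def)
    fix w w' b assume w: "ghom B X w" "ghom B X w'" and b: "b \<in> fst B"
      and eq: "\<And>a. a \<in> fst I \<Longrightarrow> w (p a) = w' (p a)"
    \<comment> \<open>On the image of \<open>C'\<close>, both maps are determined by their
      restriction to \<open>C\<close>, which factors through \<open>I\<close>.\<close>
    have "w (q x) = w' (q x)" if "x \<in> fst C'" for x
      using orth_unique[OF orth ghom_comp[OF q w(1)] ghom_comp[OF q w(2)] _ that]
      by (simp add: pq eq ghom_pts[OF c])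
    then show "w b = w' b" using cases[OF b] eq by auto
  next
    have orth: "orth C C' f X" using f X by (simp add: perp_def)
    fix u assume u: "ghom I X u"
    obtain v where v: "ghom C' X v" "\<forall>x\<in>fst C. v (f x) = u (c x)"
      using orth_exists[OF orth ghom_comp[OF c u]] by blast
    have compat: "compat X u v" unfolding compat_def using X u v by blast
    \<comment> \<open>As a compatible pair, \<open>u\<close> and \<open>v\<close> cannot distinguish
      equivalent elements, so they descend to the quotient.\<close>
    define w where "w y = case_sum u v (inv_into ?S k y)" for y
    have w: "w (cl z) = case_sum u v z" if "z \<in> ?S" for z
    proof -
      have "w (cl z) = case_sum u v (r z)" using r[OF that] k(1) by (simp add: w_def cl_def)
      also have "\<dots> = case_sum u v z" using r[OF that] compat unfolding eqv_def by metis
      finally show ?thesis .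
    qed
    have wp: "w (p x) = u x" if "x \<in> fst I" for x using w[OF InlI[OF that]] by (simp add: p_def)
    have wq: "w (q x) = v x" if "x \<in> fst C'" for x using w[OF InrI[OF that]] by (simp add: q_def)
    have "ghom B X w"
    proof (rule ghomI)
      show "w y \<in> fst X" if "y \<in> fst B" for y
        using cases[OF that] wp wq ghom_pts[OF u] ghom_pts[OF v(1)] by auto
      fix y y' assume "(y, y') \<in> snd B"
      then consider x x' where "(x, x') \<in> snd I" "y = p x" "y' = p x'"
        | x x' where "(x, x') \<in> snd C'" "y = q x" "y' = q x'"
        by (auto simp: B_def p_def q_def)
      then show "(w y, w y') \<in> snd X"
      proof cases
        case 1
        then have "x \<in> fst I" "x' \<in> fst I" using I by (auto simp: Obj_graph_cat)
        then show ?thesis using ghom_edges[OF u 1(1)] by (simp add: 1 wp)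
      next
        case 2
        then have "x \<in> fst C'" "x' \<in> fst C'" using C' by (auto simp: Obj_graph_cat)
        then show ?thesis using ghom_edges[OF v(1) 2(1)] by (simp add: 2 wq)
      qed
    qed
    then show "\<exists>w. ghom B X w \<and> (\<forall>a\<in>fst I. w (p a) = u a)" using wp by blast
  qed
  then have "perp elts D I B p" using I B p by (simp add: perp_def)
  then show ?thesis using q pq by blast
qed

end

section \<open>Hulls and reflections\<close>

definition hull_pts :: "('v \<Rightarrow> 'v set) \<Rightarrow> 'v graph set \<Rightarrow> 'v graph \<Rightarrow> 'v graph \<Rightarrow> ('v \<Rightarrow> 'v) \<Rightarrow> 'v set" where
  "hull_pts elts D A X h = {g b |B f g b.
    perp elts D A B f \<and> ghom B X g \<and> (\<forall>a\<in>fst A. g (f a) = h a) \<and> b \<in> fst B}"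

definition hull_edges :: "('v \<Rightarrow> 'v set) \<Rightarrow> 'v graph set \<Rightarrow> 'v graph \<Rightarrow> 'v graph \<Rightarrow> ('v \<Rightarrow> 'v) \<Rightarrow> 'v rel" where
  "hull_edges elts D A X h = {(g b, g b') |B f g b b'.
    perp elts D A B f \<and> ghom B X g \<and> (\<forall>a\<in>fst A. g (f a) = h a) \<and> (b, b') \<in> snd B}"

definition hull :: "('v \<Rightarrow> 'v set) \<Rightarrow> 'v graph set \<Rightarrow> 'v graph \<Rightarrow> 'v graph \<Rightarrow> ('v \<Rightarrow> 'v) \<Rightarrow> 'v graph" where
  "hull elts D A X h = (hull_pts elts D A X h, hull_edges elts D A X h)"

lemma fst_hull [simp]: "fst (hull elts D A X h) = hull_pts elts D A X h"
  and snd_hull [simp]: "snd (hull elts D A X h) = hull_edges elts D A X h"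
  by (simp_all add: hull_def)

lemma hull_edges_subset: "hull_edges elts D A X h \<subseteq> hull_pts elts D A X h \<times> hull_pts elts D A X h"
proof
  fix e assume "e \<in> hull_edges elts D A X h"
  then obtain B f g b b' where *: "perp elts D A B f" "ghom B X g" "\<forall>a\<in>fst A. g (f a) = h a"
    "(b, b') \<in> snd B" "e = (g b, g b')" unfolding hull_edges_def by blast
  moreover have "b \<in> fst B" "b' \<in> fst B" using *(1,4) by (auto simp: perp_def Obj_graph_cat)
  ultimately show "e \<in> hull_pts elts D A X h \<times> hull_pts elts D A X h"
    unfolding hull_pts_def by blast
qed

lemma ghom_hull_incl: "ghom (hull elts D A X h) X (\<lambda>x. x)"
proof (rule ghomI)
  show "x \<in> fst X" if "x \<in> fst (hull elts D A X h)" for x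
    using that by (auto simp: hull_pts_def intro: ghom_pts)
  show "(x, y) \<in> snd X" if "(x, y) \<in> snd (hull elts D A X h)" for x y
    using that by (auto simp: hull_edges_def intro: ghom_edges)
qed

lemma ghom_into_hull:
  assumes "perp elts D A B f" "ghom B X g" "\<And>a. a \<in> fst A \<Longrightarrow> g (f a) = h a"
  shows "ghom B (hull elts D A X h) g"
proof (rule ghomI)
  show "g b \<in> fst (hull elts D A X h)" if "b \<in> fst B" for b
    unfolding fst_hull hull_pts_def using assms that by blast
  show "(g b, g b') \<in> snd (hull elts D A X h)" if "(b, b') \<in> snd B" for b b'
    unfolding snd_hull hull_edges_def using assms that by blast
qed

lemma ghom_hull:
  assumes "A \<in> Obj (graph_cat elts)" "ghom A X h"
  shows "ghom A (hull elts D A X h) h"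
  by (rule ghom_into_hull[OF perp_id[OF assms(1)] assms(2)]) simp

text \<open>Each point of the hull comes from some \<open>B\<close>, and a map from \<open>B\<close>
  to a member of \<open>D\<close> is determined by its restriction to \<open>A\<close>.\<close>

lemma hull_unique:
  assumes e: "ghom (hull elts D A X h) Y e" "ghom (hull elts D A X h) Y e'" and Y: "Y \<in> D"
    and eq: "\<And>a. a \<in> fst A \<Longrightarrow> e (h a) = e' (h a)" and x: "x \<in> hull_pts elts D A X h"
  shows "e x = e' x"
proof -
  obtain B f g b where *: "perp elts D A B f" "ghom B X g" "\<forall>a\<in>fst A. g (f a) = h a"
    and b: "b \<in> fst B" "x = g b" using x unfolding hull_pts_def by blast
  have g: "ghom B (hull elts D A X h) g" using * by (intro ghom_into_hull) auto
  have "orth A B f Y" using *(1) Y by (simp add: perp_def)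
  then show ?thesis
    unfolding b(2) by (rule orth_unique[OF _ ghom_comp[OF g e(1)] ghom_comp[OF g e(2)] _ b(1)])
      (use *(3) eq in simp)
qed

text \<open>Extend \<open>h'\<close> along the map from \<open>A\<close> to \<open>B\<close>;
  followed by \<open>\<pi>\<close> this is the given extension of \<open>h\<close>, by uniqueness in
  \<open>X\<close>. Covering the edges too is what later makes the inverse of a bijective projection
  a graph map.\<close>

lemma hull_lift:
  assumes X: "X \<in> D" and Y: "Y \<in> D" and h': "ghom A Y h'"
    and \<pi>: "ghom Y X \<pi>" and eq: "\<And>a. a \<in> fst A \<Longrightarrow> \<pi> (h' a) = h a"
  shows "x \<in> hull_pts elts D A X h \<Longrightarrow> \<exists>y\<in>hull_pts elts D A Y h'. \<pi> y = x"
    and "(x, x') \<in> hull_edges elts D A X h \<Longrightarrow> \<exists>(y, y')\<in>hull_edges elts D A Y h'. \<pi> y = x \<and> \<pi> y' = x'"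
proof -
  have lift: "\<exists>g'. ghom B Y g' \<and> (\<forall>a\<in>fst A. g' (f a) = h' a) \<and> (\<forall>b\<in>fst B. \<pi> (g' b) = g b)"
    if B: "perp elts D A B f" "ghom B X g" "\<forall>a\<in>fst A. g (f a) = h a" for B f g
  proof -
    have orth: "orth A B f X" "orth A B f Y" using B(1) X Y by (auto simp: perp_def)
    obtain g' where g': "ghom B Y g'" "\<forall>a\<in>fst A. g' (f a) = h' a"
      using orth_exists[OF orth(2) h'] by blast
    have "\<pi> (g' b) = g b" if "b \<in> fst B" for b
      by (rule orth_unique[OF orth(1) ghom_comp[OF g'(1) \<pi>] B(2) _ that]) (use g'(2) B(3) eq in simp)
    then show ?thesis using g' by blast
  qed
  show "\<exists>y\<in>hull_pts elts D A Y h'. \<pi> y = x" if x: "x \<in> hull_pts elts D A X h"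
  proof -
    obtain B f g b where *: "perp elts D A B f" "ghom B X g" "\<forall>a\<in>fst A. g (f a) = h a"
      and b: "b \<in> fst B" "x = g b" using x unfolding hull_pts_def by blast
    obtain g' where g': "ghom B Y g'" "\<forall>a\<in>fst A. g' (f a) = h' a" "\<forall>b\<in>fst B. \<pi> (g' b) = g b"
      using lift[OF *] by blast
    then have "g' b \<in> hull_pts elts D A Y h'" using *(1) b(1) unfolding hull_pts_def by blast
    then show ?thesis using g'(3) b by blast
  qed
  show "\<exists>(y, y')\<in>hull_edges elts D A Y h'. \<pi> y = x \<and> \<pi> y' = x'" if x: "(x, x') \<in> hull_edges elts D A X h"
  proof -
    obtain B f g b b' where *: "perp elts D A B f" "ghom B X g" "\<forall>a\<in>fst A. g (f a) = h a"
      and b: "(b, b') \<in> snd B" "x = g b" "x' = g b'" using x unfolding hull_edges_def by blast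
    obtain g' where g': "ghom B Y g'" "\<forall>a\<in>fst A. g' (f a) = h' a" "\<forall>b\<in>fst B. \<pi> (g' b) = g b"
      using lift[OF *] by blast
    then have "(g' b, g' b') \<in> hull_edges elts D A Y h'"
      using *(1) b(1) unfolding hull_edges_def by blast
    moreover have "b \<in> fst B" "b' \<in> fst B" using *(1) b(1) by (auto simp: perp_def Obj_graph_cat)
    ultimately show ?thesis using g'(3) b by auto
  qed
qed

lemma perp_objects_iff:
  assumes "E \<subseteq> Mor (graph_cat elts)"
  shows "X \<in> perp_objects (graph_cat elts) E \<longleftrightarrow>
    X \<in> Obj (graph_cat elts) \<and> (\<forall>(C, C', f)\<in>E. orth C C' f X)"
proof -
  have "orthogonal (graph_cat elts) (C, C', f) X \<longleftrightarrow> orth C C' f X" if "(C, C', f) \<in> E" for C C' f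
    using that assms by (intro orthogonal_iff_orth) (auto simp: Mor_def graph_hom_ghom)
  then show ?thesis by (auto simp: perp_objects_def simp del: orthogonal.simps)
qed

section \<open>Reflections from bounded hulls, and the origin of the bound\<close>

context zfc_universe
begin

text \<open>A map into a product is a family of maps into the factors, so orthogonality can be
  tested factor by factor.\<close>

lemma perp_objects_product:
  assumes E: "E \<subseteq> Mor (graph_cat elts)" and D: "D = perp_objects (graph_cat elts) E"
    and K: "sized elts K" and X: "\<And>k. k \<in> K \<Longrightarrow> X k \<in> D"
  shows "\<exists>P \<pi>. P \<in> D \<and> (\<forall>k\<in>K. ghom P (X k) (\<pi> k)) \<and>
    (\<forall>Z\<in>Obj (graph_cat elts). \<forall>h. (\<forall>k\<in>K. ghom Z (X k) (h k)) \<longrightarrow>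
      (\<exists>g. ghom Z P g \<and> (\<forall>k\<in>K. \<forall>z\<in>fst Z. \<pi> k (g z) = h k z)))"
proof -
  have "X k \<in> Obj (graph_cat elts)" if "k \<in> K" for k
    using X[OF that] by (simp add: D perp_objects_def)
  from product[where X = X, OF K this] obtain P \<pi> where P: "P \<in> Obj (graph_cat elts)"
    and \<pi>: "\<forall>k\<in>K. ghom P (X k) (\<pi> k)"
    and inj: "\<forall>x\<in>fst P. \<forall>y\<in>fst P. (\<forall>k\<in>K. \<pi> k x = \<pi> k y) \<longrightarrow> x = y"
    and univ: "\<forall>Z\<in>Obj (graph_cat elts). \<forall>h. (\<forall>k\<in>K. ghom Z (X k) (h k)) \<longrightarrow>
      (\<exists>g. ghom Z P g \<and> (\<forall>k\<in>K. \<forall>z\<in>fst Z. \<pi> k (g z) = h k z))"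
    by blast
  have "orth C C' f P" if e: "(C, C', f) \<in> E" for C C' f
  proof (rule orthI)
    have orth: "orth C C' f (X k)" if "k \<in> K" for k
      using X[OF that] e unfolding D perp_objects_iff[OF E] by blast
    have C: "C' \<in> Obj (graph_cat elts)" "ghom C C' f"
      using E e by (auto simp: Mor_def graph_hom_ghom)
    {
      fix g g' b assume g: "ghom C' P g" "ghom C' P g'" and eq: "\<And>a. a \<in> fst C \<Longrightarrow> g (f a) = g' (f a)"
        and b: "b \<in> fst C'"
      have "\<pi> k (g b) = \<pi> k (g' b)" if k: "k \<in> K" for k
      proof -
        have pk: "ghom P (X k) (\<pi> k)" using \<pi> k by blast
        show ?thesis
          by (rule orth_unique[OF orth[OF k] ghom_comp[OF g(1) pk] ghom_comp[OF g(2) pk] _ b]) (simp add: eq)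
      qed
      then show "g b = g' b" using inj ghom_pts[OF g(1) b] ghom_pts[OF g(2) b] by blast
    }
    fix h assume h: "ghom C P h"
    have "\<forall>k\<in>K. \<exists>u. ghom C' (X k) u \<and> (\<forall>a\<in>fst C. u (f a) = \<pi> k (h a))"
      using orth_exists[OF orth ghom_comp[OF h]] \<pi> by blast
    then obtain u where u: "\<forall>k\<in>K. ghom C' (X k) (u k) \<and> (\<forall>a\<in>fst C. u k (f a) = \<pi> k (h a))"
      using bchoice[of K "\<lambda>k u. ghom C' (X k) u \<and> (\<forall>a\<in>fst C. u (f a) = \<pi> k (h a))"] by blast
    then obtain g where g: "ghom C' P g" "\<forall>k\<in>K. \<forall>z\<in>fst C'. \<pi> k (g z) = u k z"
      using univ C(1) by blast
    have "g (f a) = h a" if a: "a \<in> fst C" for a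
    proof -
      have fa: "f a \<in> fst C'" using C(2) a by (rule ghom_pts)
      have "\<forall>k\<in>K. \<pi> k (g (f a)) = \<pi> k (h a)" using g(2) u fa a by simp
      then show ?thesis using inj ghom_pts[OF g(1) fa] ghom_pts[OF h a] by blast
    qed
    then show "\<exists>g. ghom C' P g \<and> (\<forall>a\<in>fst C. g (f a) = h a)" using g(1) by blast
  qed
  then have "P \<in> D" using P unfolding D perp_objects_iff[OF E] by blast
  then show ?thesis using \<pi> univ by blast
qed

lemma hull_Obj: "X \<in> Obj (graph_cat elts) \<Longrightarrow> hull elts D A X h \<in> Obj (graph_cat elts)"
  using hull_edges_subset[of elts D A X h] ghom_pts[OF ghom_hull_incl[of elts D A X h]]
  by (auto simp: Obj_graph_cat intro: small_subset)

text \<open>Up to isomorphism only a set of hulls occurs if their sizes are bounded. The hull of \<open>A\<close> in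
  the product of one target for each of them is the reflection of \<open>A\<close>.\<close>

lemma reflection_if_hulls_bounded:
  assumes E: "E \<subseteq> Mor (graph_cat elts)" and D: "D = perp_objects (graph_cat elts) E"
    and A: "A \<in> Obj (graph_cat elts)" and L: "small elts L"
    and bound: "\<And>X h. X \<in> D \<Longrightarrow> ghom A X h \<Longrightarrow>
      \<exists>j. inj_on j (hull_pts elts D A X h) \<and> j ` hull_pts elts D A X h \<subseteq> L"
  shows "\<exists>I\<in>D. \<exists>i. perp elts D A I i"
proof -
  let ?V = "hull_pts elts D A" and ?E = "hull_edges elts D A" and ?H = "hull elts D A"
  have DObj: "X \<in> Obj (graph_cat elts)" if "X \<in> D" for X using that by (simp add: D perp_objects_def)
  define M where "M = {(X, h). X \<in> D \<and> ghom A X h}"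
  have "\<forall>m\<in>M. \<exists>j. inj_on j (?V (fst m) (snd m)) \<and> j ` ?V (fst m) (snd m) \<subseteq> L"
    using bound by (auto simp: M_def)
  then obtain j where j: "\<forall>m\<in>M. inj_on (j m) (?V (fst m) (snd m)) \<and> j m ` ?V (fst m) (snd m) \<subseteq> L"
    using bchoice[of M "\<lambda>m j. inj_on j (?V (fst m) (snd m)) \<and> j ` ?V (fst m) (snd m) \<subseteq> L"] by blast
  \<comment> \<open>The isomorphism type of a hull under \<open>A\<close>: its points, its edges and
    the map from \<open>A\<close>, transported into \<open>L\<close>. These triples form a set even
    if \<open>M\<close> is a proper class.\<close>
  define ty where "ty m = (j m ` ?V (fst m) (snd m), map_prod (j m) (j m) ` ?E (fst m) (snd m),
    \<lambda>a\<in>fst A. j m (snd m a))" for m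
  have memV: "snd m a \<in> ?V (fst m) (snd m)" if "m \<in> M" "a \<in> fst A" for m a
    using ghom_pts[OF ghom_hull[OF A, of "fst m" "snd m" D] that(2)] that(1) by (auto simp: M_def)
  have "ty ` M \<subseteq> Pow L \<times> Pow (L \<times> L) \<times> (fst A \<rightarrow>\<^sub>E L)"
  proof
    fix k assume "k \<in> ty ` M"
    then obtain m where m: "m \<in> M" "k = ty m" by blast
    have V: "j m ` ?V (fst m) (snd m) \<subseteq> L" using j m(1) by blast
    then have "map_prod (j m) (j m) ` ?E (fst m) (snd m) \<subseteq> L \<times> L"
      using hull_edges_subset[of elts D A "fst m" "snd m"] by fastforce
    moreover have "(\<lambda>a\<in>fst A. j m (snd m a)) \<in> fst A \<rightarrow>\<^sub>E L"
      using V memV[OF m(1)] by auto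
    ultimately show "k \<in> Pow L \<times> Pow (L \<times> L) \<times> (fst A \<rightarrow>\<^sub>E L)" using V by (simp add: m(2) ty_def)
  qed
  moreover have "sized elts (Pow L \<times> Pow (L \<times> L) \<times> (fst A \<rightarrow>\<^sub>E L))"
    using L A by (intro sized_Times sized_Pow sized_PiE) (simp_all add: sized_iff_small Obj_graph_cat)
  ultimately have K: "sized elts (ty ` M)" using sized_subset by blast
  define rep where "rep = inv_into M ty"
  have rep: "rep k \<in> M \<and> ty (rep k) = k" if "k \<in> ty ` M" for k
    using that by (simp add: rep_def inv_into_into f_inv_into_f)
  have rep': "fst (rep k) \<in> D" "ghom A (fst (rep k)) (snd (rep k))" if "k \<in> ty ` M" for k
    using rep[OF that] by (auto simp: M_def)
  from perp_objects_product[where X = "\<lambda>k. fst (rep k)", OF E D K rep'(1)]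
  obtain P \<pi> where P: "P \<in> D" and \<pi>': "\<forall>k\<in>ty ` M. ghom P (fst (rep k)) (\<pi> k)"
    and univ: "\<forall>Z\<in>Obj (graph_cat elts). \<forall>h. (\<forall>k\<in>ty ` M. ghom Z (fst (rep k)) (h k)) \<longrightarrow>
      (\<exists>g. ghom Z P g \<and> (\<forall>k\<in>ty ` M. \<forall>z\<in>fst Z. \<pi> k (g z) = h k z))"
    by blast
  have \<pi>: "ghom P (fst (rep k)) (\<pi> k)" if "k \<in> ty ` M" for k using \<pi>' that by blast
  have "\<forall>k\<in>ty ` M. ghom A (fst (rep k)) (snd (rep k))" using rep'(2) by blast
  from bspec[OF univ A, THEN spec, of "\<lambda>k. snd (rep k)", THEN mp, OF this]
  obtain i where i: "ghom A P i" and \<pi>_i: "\<And>k a. k \<in> ty ` M \<Longrightarrow> a \<in> fst A \<Longrightarrow> \<pi> k (i a) = snd (rep k) a"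
    by blast
  let ?I = "?H P i"
  have I: "?I \<in> Obj (graph_cat elts)" using DObj[OF P] by (rule hull_Obj)
  have iI: "ghom A ?I i" using A i by (rule ghom_hull)
  have extend: "\<exists>e. ghom ?I X e \<and> (\<forall>a\<in>fst A. e (i a) = h a)" if X: "X \<in> D" and h: "ghom A X h" for X h
  proof -
    \<comment> \<open>\<open>Y\<close> is the product of \<open>P\<close> and \<open>X\<close>, and
      \<open>u\<close> has components \<open>i\<close> and \<open>h\<close>. The hull of
      \<open>u\<close> is isomorphic to the hull of a representative, whose target is a factor of
      \<open>P\<close>; hence the projection \<open>p True\<close> is injective on it. It also
      covers \<open>?I\<close>, so the extension of \<open>h\<close> is \<open>p False\<close> after
      the inverse of \<open>p True\<close>.\<close>
    have "(if b then P else X) \<in> D" if "b \<in> UNIV" for b using P X by simp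
    from perp_objects_product[where X = "\<lambda>b. if b then P else X", OF E D sized_countable this]
    obtain Y p where Y: "Y \<in> D" and p: "\<forall>b\<in>UNIV. ghom Y (if b then P else X) (p b)"
      and univ2: "\<forall>Z\<in>Obj (graph_cat elts). \<forall>h. (\<forall>b\<in>UNIV. ghom Z (if b then P else X) (h b)) \<longrightarrow>
        (\<exists>g. ghom Z Y g \<and> (\<forall>b\<in>UNIV. \<forall>z\<in>fst Z. p b (g z) = h b z))"
      by blast
    have p1: "ghom Y P (p True)" and p2: "ghom Y X (p False)"
      using p[rule_format, of True] p[rule_format, of False] by simp_all
    have "\<forall>b\<in>UNIV. ghom A (if b then P else X) (if b then i else h)" using i h by simp
    from bspec[OF univ2 A, THEN spec, of "\<lambda>b. if b then i else h", THEN mp, OF this]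
    obtain u where u: "ghom A Y u" and pu: "\<forall>b\<in>UNIV. \<forall>a\<in>fst A. p b (u a) = (if b then i else h) a"
      by blast
    have pu1: "p True (u a) = i a" and pu2: "p False (u a) = h a" if "a \<in> fst A" for a
      using bspec[OF pu, of True] bspec[OF pu, of False] that by simp_all
    have m: "(Y, u) \<in> M" using Y u by (simp add: M_def)
    define k where "k = ty (Y, u)"
    have k: "k \<in> ty ` M" unfolding k_def using m by blast
    obtain Xk hk where r: "rep k = (Xk, hk)" by fastforce
    have Xk: "Xk \<in> D" using rep'(1)[OF k] by (simp add: r)
    have rM: "(Xk, hk) \<in> M" and "ty (Xk, hk) = ty (Y, u)"
      using rep[OF k, unfolded r] k_def by simp_all
    then have tV: "j (Xk, hk) ` ?V Xk hk = j (Y, u) ` ?V Y u"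
      and tE: "map_prod (j (Xk, hk)) (j (Xk, hk)) ` ?E Xk hk = map_prod (j (Y, u)) (j (Y, u)) ` ?E Y u"
      and th: "(\<lambda>a\<in>fst A. j (Xk, hk) (hk a)) = (\<lambda>a\<in>fst A. j (Y, u) (u a))"
      by (simp_all add: ty_def)
    have jk: "inj_on (j (Xk, hk)) (?V Xk hk)" and jY: "inj_on (j (Y, u)) (?V Y u)"
      using j rM m by auto
    \<comment> \<open>The isomorphism of the hull of \<open>u\<close> with that of the
      representative, through their common copy in \<open>L\<close>.\<close>
    define \<theta> where "\<theta> y = inv_into (?V Xk hk) (j (Xk, hk)) (j (Y, u) y)" for y
    have \<theta>: "\<theta> y \<in> ?V Xk hk" "j (Xk, hk) (\<theta> y) = j (Y, u) y" if "y \<in> ?V Y u" for y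
    proof -
      have "j (Y, u) y \<in> j (Xk, hk) ` ?V Xk hk" unfolding tV using that by blast
      then show "\<theta> y \<in> ?V Xk hk" "j (Xk, hk) (\<theta> y) = j (Y, u) y"
        unfolding \<theta>_def by (simp_all add: inv_into_into f_inv_into_f)
    qed
    have \<theta>_eq: "\<theta> y = x" if "x \<in> ?V Xk hk" "j (Xk, hk) x = j (Y, u) y" for x y
      using jk that(1) unfolding \<theta>_def that(2)[symmetric] by simp
    have \<theta>_hom: "ghom (?H Y u) Xk \<theta>"
    proof (rule ghomI)
      show "\<theta> y \<in> fst Xk" if "y \<in> fst (?H Y u)" for y
        using ghom_pts[OF ghom_hull_incl, of "\<theta> y" elts D A Xk hk] \<theta>(1) that by simp
      fix y y' assume "(y, y') \<in> snd (?H Y u)"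
      then have "map_prod (j (Y, u)) (j (Y, u)) (y, y') \<in> map_prod (j (Xk, hk)) (j (Xk, hk)) ` ?E Xk hk"
        unfolding tE snd_hull by (rule imageI)
      then obtain x x' where x: "(x, x') \<in> ?E Xk hk" "j (Xk, hk) x = j (Y, u) y" "j (Xk, hk) x' = j (Y, u) y'"
        by auto
      then have "x \<in> ?V Xk hk" "x' \<in> ?V Xk hk" using hull_edges_subset by blast+
      then have "\<theta> y = x" "\<theta> y' = x'" using \<theta>_eq x by blast+
      then show "(\<theta> y, \<theta> y') \<in> snd Xk"
        using ghom_edges[OF ghom_hull_incl, of x x' elts D A Xk hk] x(1) by simp
    qed
    have \<theta>_u: "\<theta> (u a) = hk a" if "a \<in> fst A" for a
      using fun_cong[OF th, of a] that memV[OF rM that] by (intro \<theta>_eq) simp_all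
    have \<pi>k: "ghom P Xk (\<pi> k)" using \<pi>[OF k] by (simp add: r)
    \<comment> \<open>Both maps send \<open>u a\<close> to \<open>hk a\<close>, so they agree on the
      whole hull. As \<open>\<theta>\<close> is injective, so is \<open>p True\<close>
      there.\<close>
    have \<theta>_\<pi>: "\<pi> k (p True y) = \<theta> y" if "y \<in> ?V Y u" for y
    proof (rule hull_unique[OF _ \<theta>_hom Xk _ that])
      show "ghom (?H Y u) Xk (\<lambda>y. \<pi> k (p True y))"
        by (rule ghom_comp[OF ghom_hull_incl ghom_comp[OF p1 \<pi>k]])
      show "\<pi> k (p True (u a)) = \<theta> (u a)" if "a \<in> fst A" for a
        using \<pi>_i[OF k that] \<theta>_u[OF that] pu1[OF that] by (simp add: r)
    qed
    have inj: "inj_on (p True) (?V Y u)"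
    proof (rule inj_onI)
      fix y y' assume y: "y \<in> ?V Y u" "y' \<in> ?V Y u" "p True y = p True y'"
      then have "\<theta> y = \<theta> y'" using \<theta>_\<pi> by metis
      then show "y = y'" using \<theta>(2)[OF y(1)] \<theta>(2)[OF y(2)] inj_onD[OF jY _ y(1,2)] by simp
    qed
    define e where "e x = p False (inv_into (?V Y u) (p True) x)" for x
    have e: "e (p True y) = p False y" if "y \<in> ?V Y u" for y
      using inj that by (simp add: e_def)
    have "ghom ?I X e"
    proof (rule ghomI)
      fix x assume "x \<in> fst ?I"
      then obtain y where y: "y \<in> ?V Y u" "p True y = x"
        using hull_lift(1)[OF P Y u p1 pu1, of x elts] by auto
      then have "y \<in> fst Y" using ghom_pts[OF ghom_hull_incl, of y elts D A Y u] by simp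
      then show "e x \<in> fst X" using e[OF y(1)] y(2) ghom_pts[OF p2] by auto
    next
      fix x x' assume "(x, x') \<in> snd ?I"
      then obtain y y' where y: "(y, y') \<in> ?E Y u" "p True y = x" "p True y' = x'"
        using hull_lift(2)[OF P Y u p1 pu1, of x x' elts] by auto
      have "(p False y, p False y') \<in> snd X"
        using y(1) ghom_edges[OF ghom_comp[OF ghom_hull_incl p2], of y y' elts D A u] by simp
      moreover have "y \<in> ?V Y u" "y' \<in> ?V Y u" using y(1) hull_edges_subset by blast+
      ultimately show "(e x, e x') \<in> snd X" using e y(2,3) by auto
    qed
    moreover have "e (i a) = h a" if "a \<in> fst A" for a
      using e[of "u a"] memV[OF m that] pu1[OF that] pu2[OF that] by simp
    ultimately show ?thesis by blast
  qed
  have perp: "perp elts D A ?I i"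
    unfolding perp_def
  proof (intro conjI ballI)
    show "orth A ?I i X" if X: "X \<in> D" for X
    proof (rule orthI)
      show "g b = g' b" if "ghom ?I X g" "ghom ?I X g'" "\<And>a. a \<in> fst A \<Longrightarrow> g (i a) = g' (i a)"
        "b \<in> fst ?I" for g g' b
        using hull_unique[OF that(1,2) X that(3)] that(4) by simp
    qed (rule extend[OF X])
  qed (use A I iI in auto)
  have "orth C C' f ?I" if e: "(C, C', f) \<in> E" for C C' f
  proof (rule orthI)
    have orthP: "orth C C' f P" using P e unfolding D perp_objects_iff[OF E] by blast
    have "C \<in> Obj (graph_cat elts)" "C' \<in> Obj (graph_cat elts)" "ghom C C' f"
      using E e by (auto simp: Mor_def graph_hom_ghom)
    moreover have "orth C C' f X" if "X \<in> D" for X using that e unfolding D perp_objects_iff[OF E] by blast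
    ultimately have perp_f: "perp elts D C C' f" by (simp add: perp_def)
    {
      fix g g' b assume g: "ghom C' ?I g" "ghom C' ?I g'" and eq: "\<And>a. a \<in> fst C \<Longrightarrow> g (f a) = g' (f a)"
        and b: "b \<in> fst C'"
      show "g b = g' b"
        using orth_unique[OF orthP ghom_comp[OF g(1) ghom_hull_incl] ghom_comp[OF g(2) ghom_hull_incl] eq b] .
    }
    fix c assume c: "ghom C ?I c"
    \<comment> \<open>Cobase change of \<open>f\<close> along \<open>c\<close> yields a map from
      \<open>?I\<close> to \<open>B\<close> orthogonal to \<open>D\<close>. Extending
      \<open>i\<close> along the composite from \<open>A\<close> to \<open>B\<close> gives a
      retraction \<open>g\<close> back onto \<open>?I\<close>, and \<open>C'\<close> reaches
      \<open>?I\<close> through \<open>B\<close> and \<open>g\<close>.\<close>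
    obtain B p q where B: "perp elts D ?I B p" and q: "ghom C' B q" "\<forall>x\<in>fst C. q (f x) = p (c x)"
      using perp_pushout[OF perp_f I c] by blast
    have AB: "perp elts D A B (\<lambda>x. p (i x))" using perp B by (rule perp_comp)
    have "orth A B (\<lambda>x. p (i x)) P" using AB P by (simp add: perp_def)
    from orth_exists[OF this i] obtain g where g: "ghom B P g" "\<forall>a\<in>fst A. g (p (i a)) = i a"
      by blast
    have "ghom ?I B p" using B by (simp add: perp_def)
    from ghom_comp[OF this g(1)] have gp: "g (p x) = x" if "x \<in> ?V P i" for x
      by (rule hull_unique[OF _ ghom_hull_incl P _ that]) (use g(2) in simp)
    have "ghom B ?I g" using AB g by (intro ghom_into_hull) auto
    with q(1) have "ghom C' ?I (\<lambda>x. g (q x))" by (rule ghom_comp)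
    moreover have "g (q (f x)) = c x" if "x \<in> fst C" for x
      using q(2) gp ghom_pts[OF c that] that by simp
    ultimately show "\<exists>g. ghom C' ?I g \<and> (\<forall>x\<in>fst C. g (f x) = c x)" by blast
  qed
  then have "?I \<in> D" using I unfolding D perp_objects_iff[OF E] by blast
  then show ?thesis using perp by blast
qed

text \<open>The homomorphism \<open>\<psi>\<close> from \<open>L\<close> depends on \<open>h\<close>
  but not on \<open>B\<close>. For every \<open>B\<close>, orthogonality of \<open>L\<close> factors
  \<open>\<eta>\<close> through \<open>?T B\<close>, and orthogonality of \<open>?T X\<close> then
  identifies the map from \<open>?T B\<close> to \<open>?T X\<close> with a composite through
  \<open>\<psi>\<close>. So the image of \<open>\<psi>\<close> contains all points of the hull, and
  the same \<open>L\<close> works for all \<open>X\<close> and \<open>h\<close>.\<close>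

lemma hulls_bounded:
  assumes D: "D \<subseteq> Obj (graph_cat elts)" and A: "A \<in> Obj (graph_cat elts)"
    and ab: "\<forall>D. orthogonality_class (ab_cat elts) D \<longrightarrow> reflective (ab_cat elts) D"
  shows "\<exists>L. small elts L \<and> (\<forall>X\<in>D. \<forall>h. ghom A X h \<longrightarrow>
    (\<exists>j. inj_on j (hull_pts elts D A X h) \<and> j ` hull_pts elts D A X h \<subseteq> L))"
proof -
  let ?Ab = "ab_cat elts" and ?T = "ab_obj elts"
  \<comment> \<open>Only arrows out of the fixed \<open>A\<close> occur, so that
    \<open>\<eta>\<close> can be factored through each of them. They may form a proper
    class.\<close>
  define E' where "E' = {(?T A, ?T B, ab_map elts A B f) |B f. perp elts D A B f \<and> f \<in> extensional (fst A)}"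
  have E'_Mor: "E' \<subseteq> Mor ?Ab"
    unfolding E'_def Mor_def
    by (auto simp: perp_def graph_hom_ghom intro!: ab_obj_Obj ab_map_Hom)
  define D' where "D' = perp_objects ?Ab E'"
  have "reflective ?Ab D'"
    by (rule ab[rule_format]) (use E'_Mor in \<open>auto simp: orthogonality_class_def D'_def\<close>)
  then obtain L \<eta> where L: "L \<in> D'" and \<eta>: "(?T A, L, \<eta>) \<in> perp_morphisms ?Ab D'"
    using ab_obj_Obj[OF A] unfolding reflective_def by blast
  have LObj: "L \<in> Obj ?Ab" using L by (simp add: D'_def perp_objects_def)
  have \<eta>_Hom: "\<eta> \<in> Hom ?Ab (?T A) L" using \<eta> by (simp add: perp_morphisms_def Mor_def)
  have comp: "Comp ?Ab G u v = compose (carrier G) u v" for G u v by (simp add: ab_cat_def)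
  have TD': "?T X \<in> D'" if X: "X \<in> D" for X
    unfolding D'_def perp_objects_def
  proof (intro CollectI conjI ballI)
    show "?T X \<in> Obj ?Ab" using X D by (intro ab_obj_Obj) blast
    fix e assume "e \<in> E'"
    then obtain B f where e: "e = (?T A, ?T B, ab_map elts A B f)" and p: "perp elts D A B f"
      and f: "f \<in> extensional (fst A)" unfolding E'_def by blast
    have B: "B \<in> Obj (graph_cat elts)" and fh: "ghom A B f" and o: "orth A B f X"
      using p X by (auto simp: perp_def)
    show "orthogonal ?Ab e (?T X)"
      unfolding e
    proof (rule orthogonal_ab_obj[OF A B])
      show "X \<in> Obj (graph_cat elts)" using X D by blast
      show "f \<in> graph_hom A B" using fh f by (simp add: graph_hom_ghom)
      show "orthogonal (graph_cat elts) (A, B, f) X"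
        using o by (simp only: orthogonal_iff_orth[OF A B fh])
    qed
  qed
  have "\<exists>j. inj_on j (hull_pts elts D A X h) \<and> j ` hull_pts elts D A X h \<subseteq> carrier L"
    if X: "X \<in> D" and h: "ghom A X h" for X h
  proof -
    have XObj: "X \<in> Obj (graph_cat elts)" using X D by blast
    let ?h = "restrict h (fst A)"
    have "?h \<in> graph_hom A X" using A h by (rule restrict_graph_hom)
    then have Th: "ab_map elts A X ?h \<in> Hom ?Ab (?T A) (?T X)" by (rule ab_map_Hom[OF A XObj])
    have "orthogonal ?Ab (?T A, L, \<eta>) (?T X)"
      using \<eta> TD'[OF X] by (simp add: perp_morphisms_def del: orthogonal.simps)
    then have "bij_betw (\<lambda>g. Comp ?Ab (?T A) g \<eta>) (Hom ?Ab L (?T X)) (Hom ?Ab (?T A) (?T X))"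
      by simp
    from bij_betw_imp_surj_on[OF this] Th
    have "ab_map elts A X ?h \<in> (\<lambda>g. Comp ?Ab (?T A) g \<eta>) ` Hom ?Ab L (?T X)" by simp
    then obtain \<psi> where \<psi>: "\<psi> \<in> Hom ?Ab L (?T X)" "ab_map elts A X ?h = Comp ?Ab (?T A) \<psi> \<eta>"
      by blast
    have in_image: "ab_pt elts X x \<in> \<psi> ` carrier L" if x: "x \<in> hull_pts elts D A X h" for x
    proof -
      obtain B f g b where p: "perp elts D A B f" and g: "ghom B X g" and gf: "\<forall>a\<in>fst A. g (f a) = h a"
        and b: "b \<in> fst B" "x = g b" using x unfolding hull_pts_def by blast
      let ?f = "restrict f (fst A)" and ?g = "restrict g (fst B)"
      have B: "B \<in> Obj (graph_cat elts)" and fh: "ghom A B f" using p by (auto simp: perp_def)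
      have f': "?f \<in> graph_hom A B" using A fh by (rule restrict_graph_hom)
      have g': "?g \<in> graph_hom B X" using B g by (rule restrict_graph_hom)
      have gf': "compose (fst A) ?g ?f = ?h"
        using gf ghom_pts[OF fh] by (auto simp: compose_def)
      have p': "perp elts D A B ?f" using p by (rule perp_restrict)
      have mem: "(?T A, ?T B, ab_map elts A B ?f) \<in> E'"
        unfolding E'_def using p' restrict_extensional by blast
      have Tf: "ab_map elts A B ?f \<in> Hom ?Ab (?T A) (?T B)" by (rule ab_map_Hom[OF A B f'])
      have Tg: "ab_map elts B X ?g \<in> Hom ?Ab (?T B) (?T X)" by (rule ab_map_Hom[OF B XObj g'])
      have "orthogonal ?Ab (?T A, ?T B, ab_map elts A B ?f) L"
        using L mem by (auto simp: D'_def perp_objects_def simp del: orthogonal.simps)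
      then have bijL: "bij_betw (\<lambda>g. Comp ?Ab (?T A) g (ab_map elts A B ?f)) (Hom ?Ab (?T B) L) (Hom ?Ab (?T A) L)"
        by simp
      from bij_betw_imp_surj_on[OF bijL] \<eta>_Hom
      have "\<eta> \<in> (\<lambda>g. Comp ?Ab (?T A) g (ab_map elts A B ?f)) ` Hom ?Ab (?T B) L" by simp
      then obtain \<beta> where \<beta>: "\<beta> \<in> Hom ?Ab (?T B) L" "\<eta> = Comp ?Ab (?T A) \<beta> (ab_map elts A B ?f)"
        by blast
      interpret cat: category ?Ab by (rule category_ab_cat)
      have TA: "?T A \<in> Obj ?Ab" and TB: "?T B \<in> Obj ?Ab" and TX: "?T X \<in> Obj ?Ab"
        using A B XObj by (simp_all add: ab_obj_Obj)
      have \<psi>\<beta>: "Comp ?Ab (?T B) \<psi> \<beta> \<in> Hom ?Ab (?T B) (?T X)"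
        by (rule cat.comp_in_Hom[OF TB LObj TX \<beta>(1) \<psi>(1)])
      have "Comp ?Ab (?T A) (Comp ?Ab (?T B) \<psi> \<beta>) (ab_map elts A B ?f) = ab_map elts A X ?h"
        unfolding \<psi>(2) \<beta>(2) by (rule cat.assoc[OF TA TB LObj TX Tf \<beta>(1) \<psi>(1)])
      also have "\<dots> = Comp ?Ab (?T A) (ab_map elts B X ?g) (ab_map elts A B ?f)"
        unfolding comp ab_map_compose[OF A B f'] gf' ..
      finally have eq: "Comp ?Ab (?T A) (Comp ?Ab (?T B) \<psi> \<beta>) (ab_map elts A B ?f) =
        Comp ?Ab (?T A) (ab_map elts B X ?g) (ab_map elts A B ?f)" .
      have "orthogonal ?Ab (?T A, ?T B, ab_map elts A B ?f) (?T X)"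
        using TD'[OF X] mem by (auto simp: D'_def perp_objects_def simp del: orthogonal.simps)
      then have "inj_on (\<lambda>g. Comp ?Ab (?T A) g (ab_map elts A B ?f)) (Hom ?Ab (?T B) (?T X))"
        by (simp add: bij_betw_def)
      \<comment> \<open>Both homomorphisms agree after precomposition with
        \<open>ab_map elts A B ?f\<close>, to which \<open>?T X\<close> is orthogonal.\<close>
      then have eq': "Comp ?Ab (?T B) \<psi> \<beta> = ab_map elts B X ?g"
        using eq \<psi>\<beta> Tg by (rule inj_onD)
      have pt: "ab_pt elts B b \<in> carrier (?T B)" using b(1) by (rule ab_pt_mem)
      have "ab_pt elts X x = ab_map elts B X ?g (ab_pt elts B b)"
        using ab_map_pt[OF B b(1), of X ?g] b by simp
      also have "\<dots> = \<psi> (\<beta> (ab_pt elts B b))"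
        unfolding eq'[symmetric] comp using pt by (simp add: compose_eq)
      finally have "ab_pt elts X x = \<psi> (\<beta> (ab_pt elts B b))" .
      moreover have "\<beta> (ab_pt elts B b) \<in> carrier L"
        using \<beta>(1) pt by (auto simp: ab_cat_def hom_def)
      ultimately show ?thesis by blast
    qed
    \<comment> \<open>Choosing preimages is injective since \<open>\<psi>\<close> recovers the
      embedded points; no injectivity of \<open>\<psi>\<close> is involved.\<close>
    let ?j = "\<lambda>x. inv_into (carrier L) \<psi> (ab_pt elts X x)"
    have "hull_pts elts D A X h \<subseteq> fst X"
      using ghom_pts[OF ghom_hull_incl[of elts D A X h]] by auto
    then have "inj_on (ab_pt elts X) (hull_pts elts D A X h)"
      using inj_on_ab_pt[OF XObj] inj_on_subset by blast
    moreover have "\<psi> (?j x) = ab_pt elts X x" if "x \<in> hull_pts elts D A X h" for x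
      using in_image[OF that] by (rule f_inv_into_f)
    ultimately have "inj_on ?j (hull_pts elts D A X h)" by (metis (no_types, lifting) inj_on_def)
    moreover have "?j ` hull_pts elts D A X h \<subseteq> carrier L"
      using in_image by (auto intro: inv_into_into)
    ultimately show ?thesis by blast
  qed
  moreover have "small elts (carrier L)" using LObj by (simp add: ab_cat_def)
  ultimately show ?thesis by blast
qed

end

theorem proposition6p8:
  fixes elts :: "'v \<Rightarrow> 'v set"
  assumes "zfc_universe elts"
    and "\<not> weak_vopenka_principle elts"
  shows "\<exists>D. orthogonality_class (ab_cat elts) D \<and> \<not> reflective (ab_cat elts) D"
proof (rule ccontr)
  assume "\<not> ?thesis"
  then have ab: "\<forall>D. orthogonality_class (ab_cat elts) D \<longrightarrow> reflective (ab_cat elts) D" by blast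
  have "reflective (graph_cat elts) D" if D: "orthogonality_class (graph_cat elts) D" for D
    unfolding reflective_def
  proof
    fix A assume A: "A \<in> Obj (graph_cat elts)"
    obtain E where E: "E \<subseteq> Mor (graph_cat elts)" "D = perp_objects (graph_cat elts) E"
      using D unfolding orthogonality_class_def by blast
    have "D \<subseteq> Obj (graph_cat elts)" unfolding E(2) perp_objects_def by blast
    from zfc_universe.hulls_bounded[OF assms(1) this A ab]
    obtain L where L: "small elts L" and bound: "\<forall>X\<in>D. \<forall>h. ghom A X h \<longrightarrow>
        (\<exists>j. inj_on j (hull_pts elts D A X h) \<and> j ` hull_pts elts D A X h \<subseteq> L)"
      by (elim exE conjE) (rule that)
    have "\<exists>j. inj_on j (hull_pts elts D A X h) \<and> j ` hull_pts elts D A X h \<subseteq> L"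
      if "X \<in> D" "ghom A X h" for X h
      using bspec[OF bound that(1), THEN spec, THEN mp, OF that(2)] .
    from zfc_universe.reflection_if_hulls_bounded[OF assms(1) E A L this]
    obtain I i where "I \<in> D" "perp elts D A I i" by blast
    \<comment> \<open>Restricting \<open>i\<close> to the points of \<open>A\<close> makes it an
      arrow of the category without affecting orthogonality.\<close>
    then show "\<exists>B\<in>D. \<exists>f. (A, B, f) \<in> perp_morphisms (graph_cat elts) D"
      unfolding perp_morphisms_iff using perp_restrict restrict_extensional by blast
  qed
  then have "weak_vopenka_principle elts" unfolding weak_vopenka_principle_def by blast
  with assms(2) show False by contradiction
qed

end
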